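(* Consider the Bradley-Terry-Luce model on the random bipartite graphs $\mathcal B(n,m,d_{n,m})$, $n\le m$, with merit vectors $\boldsymbol u=\boldsymbol u^{(n,m)}\in\mathbb R^{n+m}$ normalized by $u_1=0$, and let $\alpha_{n,m}=\max_{1\le i,j\le n+m}(u_i-u_j)$. Suppose $\alpha_{n,m}=O(1)$ and $d_{n,m}=\Omega\!\left(\frac{m\log^3(n+m)}{n}\right)$. Then, with probability at least $1-2(n+m)^{-2}$, $$\|\boldsymbol u^*-\boldsymbol u\|_\infty=O\!\left(\frac{\log n}{\log\left(\frac nm d_{n,m}\right)}\sqrt{\frac{m\log(n+m)}{n\,d_{n,m}}}\right),$$ where $\boldsymbol u^*$ is the maximum likelihood estimator normalized by $u_1^*=0$. That is, there is a constant $C$ such that for all sufficiently large $n,m$ in the sequence, with probability at least $1-2(n+m)^{-2}$ the estimator $\boldsymbol u^*$ exists, is unique, and $\|\boldsymbol u^*-\boldsymbol u\|_\infty\le C\,\frac{\log n}{\log(\frac nm d_{n,m})}\sqrt{\frac{m\log(n+m)}{n d_{n,m}}}$.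
   Context: Random graph: $L=\{1,\dots,n\}$, $R=\{n+1,\dots,n+m\}$, $n\le m$, $1\le d_{n,m}\le m$. A graph $G\sim\mathcal B(n,m,d_{n,m})$ is the bipartite graph on $L\cup R$ obtained by choosing, independently for each $i\in L$, a uniformly random $d_{n,m}$-element subset of $R$ as the set of neighbours of $i$. Model: $\boldsymbol u=(u_1,\dots,u_{n+m})$ is a deterministic real vector (depending on $(n,m)$) and $f(x)=1/(1+\exp(-x))$. Given $G$, independently for each edge $\{i,j\}$ of $G$, subject $i$ beats subject $j$ with probability $f(u_i-u_j)$ and otherwise $j$ beats $i$. Let $A'_{ij}=1$ if $\{i,j\}$ is an edge and $i$ beats $j$, and $A'_{ij}=0$ otherwise. Maximum likelihood estimator: $\boldsymbol u^*$ is the maximizer, over $\boldsymbol v\in\mathbb R^{n+m}$ with $v_1=0$, of $\mathcal L(\boldsymbol v)=\sum_{1\le i\ne j\le n+m}A'_{ij}\log f(v_i-v_j)$. The asymptotic notation refers to a given sequence of pairs $(n,m)$ with $n\le m$ and both $n$ and $m$ tending to infinity. Probability is over both $G$ and the comparison outcomes. *)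

theory Defs
  imports "HOL-Probability.Probability" "HOL-Library.Landau_Symbols"
begin

(* Subjects are 1, ..., n + m, with left part {1..n} and right part {n+1..n+m}. A bipartite graph
   is given by its set of edges, each oriented from left to right: (i, j) with i \<le> n < j. *)

definition bipartite_graph_pmf :: "nat \<Rightarrow> nat \<Rightarrow> nat \<Rightarrow> (nat \<times> nat) set pmf" where
  "bipartite_graph_pmf n m d =
     map_pmf (\<lambda>nb. SIGMA i:{1..n}. nb i)
       (Pi_pmf {1..n} {} (\<lambda>_. pmf_of_set {S. S \<subseteq> {n+1..n+m} \<and> card S = d}))"

definition logistic :: "real \<Rightarrow> real" where
  "logistic x = 1 / (1 + exp (- x))"

(* An outcome w assigns to the edge (i, j) the value True if i beats j, and False if j beats i. *)

definition comparison_pmf :: "(nat \<Rightarrow> real) \<Rightarrow> (nat \<times> nat) set \<Rightarrow> (nat \<times> nat \<Rightarrow> bool) pmf" where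
  "comparison_pmf u E = Pi_pmf E False (\<lambda>(i, j). bernoulli_pmf (logistic (u i - u j)))"

definition win_matrix ::
  "(nat \<times> nat) set \<Rightarrow> (nat \<times> nat \<Rightarrow> bool) \<Rightarrow> nat \<Rightarrow> nat \<Rightarrow> real" where
  "win_matrix E w i j = of_bool ((i, j) \<in> E \<and> w (i, j) \<or> (j, i) \<in> E \<and> \<not> w (j, i))"

definition btl_pmf ::
  "nat \<Rightarrow> nat \<Rightarrow> nat \<Rightarrow> (nat \<Rightarrow> real) \<Rightarrow> (nat \<Rightarrow> nat \<Rightarrow> real) pmf" where
  "btl_pmf n m d u =
     bind_pmf (bipartite_graph_pmf n m d)
       (\<lambda>E. map_pmf (win_matrix E) (comparison_pmf u E))"

definition log_likelihood ::
  "nat \<Rightarrow> (nat \<Rightarrow> nat \<Rightarrow> real) \<Rightarrow> (nat \<Rightarrow> real) \<Rightarrow> real" where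
  "log_likelihood N A v =
     (\<Sum>i\<in>{1..N}. \<Sum>j\<in>{1..N} - {i}. A i j * ln (logistic (v i - v j)))"

(* A vector in R^N is a function that is undefined outside {1..N}; without this restriction a
   maximizer could never be unique. *)

definition is_mle :: "nat \<Rightarrow> (nat \<Rightarrow> nat \<Rightarrow> real) \<Rightarrow> (nat \<Rightarrow> real) \<Rightarrow> bool" where
  "is_mle N A = is_arg_max (log_likelihood N A) (\<lambda>v. v \<in> extensional {1..N} \<and> v 1 = 0)"

definition sup_dist :: "nat \<Rightarrow> (nat \<Rightarrow> real) \<Rightarrow> (nat \<Rightarrow> real) \<Rightarrow> real" where
  "sup_dist N v u = Max ((\<lambda>i. \<bar>v i - u i\<bar>) ` {1..N})"

definition merit_range :: "nat \<Rightarrow> (nat \<Rightarrow> real) \<Rightarrow> real" where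
  "merit_range N u = Max ((\<lambda>(i, j). u i - u j) ` ({1..N} \<times> {1..N}))"

end

theory Submission
  imports Defs
begin

text \<open>
  Write \<open>D = n d / m\<close> for the mean degree on the right, \<open>N = n + m\<close>, and \<open>\<epsilon> = sqrt (ln N / D)\<close>.
  Let \<open>v\<close> maximize the likelihood over the compact set where \<open>\<delta> = v - u\<close> has range at most \<open>1\<close>,
  and let \<open>S\<close> be an upper level set of \<open>\<delta>\<close>. Lowering \<open>v\<close> on \<open>S\<close> is a feasible direction, so the
  differences of \<open>\<delta>\<close> summed over the edges leaving \<open>S\<close> are at most a constant times the noise in
  \<open>S\<close>, which is \<open>O(\<epsilon>)\<close> times the volume of \<open>S\<close>. Hence only a small fraction of the volume of \<open>S\<close>
  leads outside the level set \<open>S'\<close> whose threshold is lower by a constant times \<open>\<epsilon>\<close>. As small sets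
  in the random graph expand, the volume of \<open>S'\<close> is at least \<open>sqrt D\<close> times that of \<open>S\<close>, and after
  \<open>O(ln n / ln D)\<close> steps the level set contains more than half of the right side. Lower level sets
  behave in the same way, so the two meet, and the range of \<open>\<delta>\<close> is \<open>O(\<epsilon> ln n / ln D) = o(1)\<close>.
  Thus \<open>v\<close> is an interior point of the constraint set, and by concavity a global maximizer; it is
  the only one because the graph is connected, again by expansion.
\<close>

subsection \<open>Moment generating functions\<close>

text \<open>The binomial theorem, grouped by subsets instead of cardinalities. It serves twice: for
  the moment generating function of \<open>card (S \<inter> B)\<close> and for the union bound over
  vertex sets.\<close>

lemma sum_Pow_power_card:
  fixes y :: "'a :: comm_semiring_1"
  assumes "finite A"
  shows "(\<Sum>T\<in>Pow A. y ^ card T) = (1 + y) ^ card A"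
  using assms
proof (induction A rule: finite_induct)
  case (insert a A)
  have inj: "inj_on (insert a) (Pow A)"
    using insert.hyps by (auto simp: inj_on_def)
  have "(\<Sum>T\<in>Pow (insert a A). y ^ card T) =
      (\<Sum>T\<in>Pow A. y ^ card T) + (\<Sum>T\<in>insert a ` Pow A. y ^ card T)"
    unfolding Pow_insert using insert.hyps by (intro sum.union_disjoint) auto
  also have "(\<Sum>T\<in>insert a ` Pow A. y ^ card T) = (\<Sum>T\<in>Pow A. y * y ^ card T)"
    unfolding sum.reindex[OF inj] o_def
  proof (rule sum.cong[OF refl])
    fix T assume T: "T \<in> Pow A"
    then have "finite T" "a \<notin> T"
      using insert.hyps by (auto intro: finite_subset)
    then show "y ^ card (insert a T) = y * y ^ card T" by simp
  qed
  finally show ?case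
    using insert by (simp add: algebra_simps sum_distrib_left[symmetric])
qed simp

text \<open>Markov's inequality for the exponential of the sum, whose expectation factors by
  independence. The Chernoff parameter is absorbed into \<open>g\<close>, and finite supports give
  integrability.\<close>

lemma Pi_pmf_chernoff:
  fixes g :: "'i \<Rightarrow> 'a \<Rightarrow> real"
  assumes "finite I" "F \<subseteq> I"
    and fin: "\<And>x. x \<in> I \<Longrightarrow> finite (set_pmf (p x))"
    and mgf: "\<And>x. x \<in> F \<Longrightarrow> measure_pmf.expectation (p x) (\<lambda>y. exp (g x y)) \<le> b x"
  shows "measure_pmf.prob (Pi_pmf I dflt p) {y. t \<le> (\<Sum>x\<in>F. g x (y x))}
           \<le> exp (- t) * (\<Prod>x\<in>F. b x)"
proof -
  let ?P = "Pi_pmf I dflt p"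
  let ?h = "\<lambda>x y. if x \<in> F then exp (g x y) else 1"
  have finP: "finite (set_pmf ?P)"
    using assms by (simp add: set_Pi_pmf finite_PiE_dflt)
  have exp_sum_eq: "exp (\<Sum>x\<in>F. g x (y x)) = (\<Prod>x\<in>I. ?h x (y x))" for y
  proof -
    have "exp (\<Sum>x\<in>F. g x (y x)) = (\<Prod>x\<in>F. exp (g x (y x)))"
      using assms by (intro exp_sum) (auto intro: finite_subset)
    also have "\<dots> = (\<Prod>x\<in>I. ?h x (y x))"
      using assms by (intro prod.mono_neutral_cong_left) auto
    finally show ?thesis .
  qed
  have "exp t * measure_pmf.prob ?P {y. t \<le> (\<Sum>x\<in>F. g x (y x))}
      \<le> measure_pmf.expectation ?P (\<lambda>y. exp (\<Sum>x\<in>F. g x (y x)))"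
  proof -
    have "measure_pmf.prob ?P {y\<in>space (measure_pmf ?P). exp t \<le> exp (\<Sum>x\<in>F. g x (y x))}
        \<le> measure_pmf.expectation ?P (\<lambda>y. exp (\<Sum>x\<in>F. g x (y x))) / exp t"
      using finP by (intro integral_Markov_inequality_measure[where A="{}"])
        (auto intro: integrable_measure_pmf_finite)
    then show ?thesis by (simp add: field_simps)
  qed
  also have "measure_pmf.expectation ?P (\<lambda>y. exp (\<Sum>x\<in>F. g x (y x)))
      = (\<Prod>x\<in>I. measure_pmf.expectation (p x) (?h x))"
    unfolding exp_sum_eq using assms
    by (intro expectation_prod_Pi_pmf) (auto intro: integrable_measure_pmf_finite)
  also have "\<dots> = (\<Prod>x\<in>F. measure_pmf.expectation (p x) (\<lambda>y. exp (g x y)))"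
    using assms by (intro prod.mono_neutral_cong_right) auto
  also have "\<dots> \<le> (\<Prod>x\<in>F. b x)"
    using mgf by (intro prod_mono) auto
  finally show ?thesis
    by (simp add: exp_minus field_simps)
qed

section \<open>Random subsets of fixed size\<close>

lemma card_supersets:
  assumes "finite M" "T \<subseteq> M" "card T \<le> d"
  shows "card {S. S \<subseteq> M \<and> card S = d \<and> T \<subseteq> S} = (card M - card T) choose (d - card T)"
proof -
  have finT: "finite T" using assms finite_subset by auto
  have "bij_betw (\<lambda>S. S \<union> T) {S. S \<subseteq> M - T \<and> card S = d - card T}
      {S. S \<subseteq> M \<and> card S = d \<and> T \<subseteq> S}"
  proof (rule bij_betwI[where g = "\<lambda>S. S - T"])
    show "(\<lambda>S. S \<union> T) \<in> {S. S \<subseteq> M - T \<and> card S = d - card T} \<rightarrow>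
        {S. S \<subseteq> M \<and> card S = d \<and> T \<subseteq> S}"
    proof (intro funcsetI, clarify)
      fix S assume S: "S \<subseteq> M - T" "card S = d - card T"
      have "finite S" using S(1) assms(1) by (meson finite_Diff finite_subset)
      then have "card (S \<union> T) = card S + card T"
        using finT S(1) by (intro card_Un_disjoint) auto
      then show "S \<union> T \<subseteq> M \<and> card (S \<union> T) = d \<and> T \<subseteq> S \<union> T"
        using S assms by auto
    qed
    show "(\<lambda>S. S - T) \<in> {S. S \<subseteq> M \<and> card S = d \<and> T \<subseteq> S} \<rightarrow>
        {S. S \<subseteq> M - T \<and> card S = d - card T}"
      using finT by (auto simp: card_Diff_subset)
  qed auto
  then have "card {S. S \<subseteq> M \<and> card S = d \<and> T \<subseteq> S} =
      card {S. S \<subseteq> M - T \<and> card S = d - card T}"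
    by (simp add: bij_betw_same_card)
  also have "\<dots> = card (M - T) choose (d - card T)"
    using assms by (intro n_subsets) auto
  also have "card (M - T) = card M - card T"
    using assms finT by (simp add: card_Diff_subset)
  finally show ?thesis .
qed

text \<open>A uniform \<open>d\<close>-subset of \<open>m\<close> points contains \<open>t\<close>
  given points with probability at most \<open>(d/m)^t\<close>: each further point costs a factor
  \<open>(d-t)/(m-t)\<close>, which is at most \<open>d/m\<close>.\<close>

lemma choose_diff_le:
  assumes "t \<le> d" "d \<le> m" "1 \<le> d"
  shows "real ((m - t) choose (d - t)) \<le> real (m choose d) * (real d / real m) ^ t"
  using assms(1)
proof (induction t)
  case (Suc t)
  have eq: "real (d - t) * real ((m - t) choose (d - t)) =
      real (m - t) * real ((m - Suc t) choose (d - Suc t))"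
    using times_binomial_minus1_eq[of "d - t" "m - t"] Suc.prems
    by (metis Suc_le_lessD diff_Suc_1 diff_diff_left plus_1_eq_Suc add.commute of_nat_mult zero_less_diff)
  have pos: "0 < real (m - t)" "0 < real m"
    using Suc.prems assms by auto
  have frac: "real (d - t) / real (m - t) \<le> real d / real m"
  proof -
    have "real t * real d \<le> real t * real m"
      using assms by (intro mult_left_mono) auto
    then show ?thesis using pos Suc.prems assms
      by (simp add: divide_simps of_nat_diff algebra_simps)
  qed
  have "real ((m - Suc t) choose (d - Suc t)) =
      real ((m - t) choose (d - t)) * (real (d - t) / real (m - t))"
    using eq pos by (simp add: field_simps)
  also have "\<dots> \<le> (real (m choose d) * (real d / real m) ^ t) * (real d / real m)"
    using Suc frac by (intro mult_mono) auto
  finally show ?case by (simp add: algebra_simps)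
qed simp

text \<open>For a single point the containment probability is exactly \<open>d/m\<close>. Equality
  matters for lower tails, where this probability is multiplied by a negative number.\<close>

lemma choose_diff_1:
  assumes "1 \<le> d" "d \<le> m"
  shows "real ((m - 1) choose (d - 1)) = real (m choose d) * (real d / real m)"
proof -
  have "real d * real (m choose d) = real m * real ((m - 1) choose (d - 1))"
    using times_binomial_minus1_eq[of d m] assms by (metis of_nat_mult less_le_trans zero_less_one)
  then show ?thesis using assms by (simp add: field_simps)
qed

text \<open>Expand \<open>x ^ |S \<inter> B|\<close> as the sum of \<open>(x - 1) ^ |T|\<close> over \<open>T \<subseteq> S \<inter> B\<close> and exchange the sums.\<close>

lemma sum_subsets_power_card_Int:
  fixes x :: real
  assumes "finite M" "B \<subseteq> M"
  shows "(\<Sum>S | S \<subseteq> M \<and> card S = d. x ^ card (S \<inter> B)) =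
    (\<Sum>T\<in>Pow B. (x - 1) ^ card T * real (card {S. S \<subseteq> M \<and> card S = d \<and> T \<subseteq> S}))"
proof -
  let ?U = "{S. S \<subseteq> M \<and> card S = d}"
  have finB: "finite B" and finU: "finite ?U"
    using assms finite_subset by auto
  have "(\<Sum>S\<in>?U. x ^ card (S \<inter> B)) = (\<Sum>S\<in>?U. \<Sum>T\<in>Pow (S \<inter> B). (x - 1) ^ card T)"
    using finB by (intro sum.cong[OF refl], subst sum_Pow_power_card) auto
  also have "\<dots> = (\<Sum>S\<in>?U. \<Sum>T\<in>Pow B. if T \<subseteq> S then (x - 1) ^ card T else 0)"
    using finB by (intro sum.cong[OF refl] sum.mono_neutral_cong_left) auto
  also have "\<dots> = (\<Sum>T\<in>Pow B. \<Sum>S\<in>?U. if T \<subseteq> S then (x - 1) ^ card T else 0)"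
    by (rule sum.swap)
  also have "\<dots> = (\<Sum>T\<in>Pow B. (x - 1) ^ card T * real (card {S. S \<subseteq> M \<and> card S = d \<and> T \<subseteq> S}))"
  proof (rule sum.cong[OF refl])
    fix T assume "T \<in> Pow B"
    have "(\<Sum>S\<in>?U. if T \<subseteq> S then (x - 1) ^ card T else 0) = (\<Sum>S\<in>?U \<inter> {S. T \<subseteq> S}. (x - 1) ^ card T)"
      using finU by (simp add: sum.If_cases)
    also have "?U \<inter> {S. T \<subseteq> S} = {S. S \<subseteq> M \<and> card S = d \<and> T \<subseteq> S}" by auto
    finally show "(\<Sum>S\<in>?U. if T \<subseteq> S then (x - 1) ^ card T else 0) =
      (x - 1) ^ card T * real (card {S. S \<subseteq> M \<and> card S = d \<and> T \<subseteq> S})" by simp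
  qed
  finally show ?thesis .
qed

lemma subsets_pmf_facts:
  assumes "finite M" "d \<le> card M"
  shows "{S. S \<subseteq> M \<and> card S = d} \<noteq> {}" "finite {S. S \<subseteq> M \<and> card S = d}"
    "card {S. S \<subseteq> M \<and> card S = d} = card M choose d"
  using obtain_subset_with_card_n[OF assms(2)] assms by (auto simp: n_subsets)

text \<open>The hypergeometric moment generating function is dominated by the binomial one. Since
  \<open>x \<ge> 1\<close>, the coefficients \<open>(x - 1) ^ card T\<close> are nonnegative, so the
  upper bound on containment probabilities can be inserted term by term.\<close>

lemma expectation_subsets_power_card_Int_le:
  fixes x :: real
  assumes M: "finite M" "B \<subseteq> M" and d: "1 \<le> d" "d \<le> card M" and x: "1 \<le> x"
  shows "measure_pmf.expectation (pmf_of_set {S. S \<subseteq> M \<and> card S = d}) (\<lambda>S. x ^ card (S \<inter> B))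
    \<le> exp ((x - 1) * real d * real (card B) / real (card M))"
proof -
  let ?U = "{S. S \<subseteq> M \<and> card S = d}"
  define q where "q = real d / real (card M)"
  have finB: "finite B" using M finite_subset by auto
  have C: "0 < real (card M choose d)" using d by simp
  have "(\<Sum>S\<in>?U. x ^ card (S \<inter> B)) =
    (\<Sum>T\<in>Pow B. (x - 1) ^ card T * real (card {S. S \<subseteq> M \<and> card S = d \<and> T \<subseteq> S}))"
    using M by (rule sum_subsets_power_card_Int)
  also have "\<dots> \<le> (\<Sum>T\<in>Pow B. real (card M choose d) * ((x - 1) * q) ^ card T)"
  proof (rule sum_mono)
    fix T assume T: "T \<in> Pow B"
    then have TM: "T \<subseteq> M" using M by auto
    have "real (card {S. S \<subseteq> M \<and> card S = d \<and> T \<subseteq> S}) \<le> real (card M choose d) * q ^ card T"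
    proof (cases "card T \<le> d")
      case True
      then show ?thesis
        using card_supersets[OF M(1) TM True] choose_diff_le[OF True d(2,1)] by (simp add: q_def)
    next
      case False
      have "card T \<le> card S" if "S \<subseteq> M" "T \<subseteq> S" for S
        using that M by (meson card_mono finite_subset)
      then have "{S. S \<subseteq> M \<and> card S = d \<and> T \<subseteq> S} = {}" using False by force
      then show ?thesis by (simp only:) (simp add: q_def)
    qed
    then have "(x - 1) ^ card T * real (card {S. S \<subseteq> M \<and> card S = d \<and> T \<subseteq> S})
        \<le> (x - 1) ^ card T * (real (card M choose d) * q ^ card T)"
      using x by (intro mult_left_mono) auto
    then show "(x - 1) ^ card T * real (card {S. S \<subseteq> M \<and> card S = d \<and> T \<subseteq> S})
        \<le> real (card M choose d) * ((x - 1) * q) ^ card T"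
      by (simp add: power_mult_distrib mult_ac)
  qed
  also have "\<dots> = real (card M choose d) * (1 + (x - 1) * q) ^ card B"
    using finB by (simp add: sum_distrib_left[symmetric] sum_Pow_power_card)
  also have "\<dots> \<le> real (card M choose d) * exp ((x - 1) * q) ^ card B"
    using x by (intro mult_left_mono power_mono exp_ge_add_one_self) (auto simp: q_def)
  also have "exp ((x - 1) * q) ^ card B = exp ((x - 1) * real d * real (card B) / real (card M))"
    by (simp add: q_def exp_of_nat_mult[symmetric] field_simps)
  finally have "(\<Sum>S\<in>?U. x ^ card (S \<inter> B)) / real (card M choose d)
      \<le> exp ((x - 1) * real d * real (card B) / real (card M))"
    using C by (simp add: field_simps)
  then show ?thesis
    using subsets_pmf_facts[OF M(1) d(2)] by (subst integral_pmf_of_set) simp_all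
qed

text \<open>The case of a single point, where the exact containment probability allows
  \<open>l\<close> of either sign. Negative \<open>l\<close> yields the lower tail of the right
  degrees.\<close>

lemma expectation_subsets_exp_mem_le:
  fixes l :: real
  assumes M: "finite M" "j \<in> M" and d: "1 \<le> d" "d \<le> card M"
  shows "measure_pmf.expectation (pmf_of_set {S. S \<subseteq> M \<and> card S = d})
      (\<lambda>S. exp (l * of_bool (j \<in> S))) \<le> exp ((exp l - 1) * real d / real (card M))"
proof -
  let ?U = "{S. S \<subseteq> M \<and> card S = d}"
  define C where "C = real (card M choose d)"
  have C: "0 < C" using d by (simp add: C_def)
  have "exp (l * of_bool (j \<in> S)) = exp l ^ card (S \<inter> {j})" for S
    by (cases "j \<in> S") auto
  then have "(\<Sum>S\<in>?U. exp (l * of_bool (j \<in> S))) = (\<Sum>S\<in>?U. exp l ^ card (S \<inter> {j}))"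
    by simp
  also have "\<dots> = (\<Sum>T\<in>Pow {j}. (exp l - 1) ^ card T * real (card {S. S \<subseteq> M \<and> card S = d \<and> T \<subseteq> S}))"
    using M by (intro sum_subsets_power_card_Int) auto
  also have "\<dots> = real (card {S. S \<subseteq> M \<and> card S = d \<and> {} \<subseteq> S})
      + (exp l - 1) * real (card {S. S \<subseteq> M \<and> card S = d \<and> {j} \<subseteq> S})"
    by (simp add: Pow_insert)
  also have "\<dots> = C * (1 + (exp l - 1) * (real d / real (card M)))"
    using card_supersets[of M "{}" d] card_supersets[of M "{j}" d] M d choose_diff_1[OF d]
    by (simp add: C_def algebra_simps)
  also have "\<dots> \<le> C * exp ((exp l - 1) * (real d / real (card M)))"
    using C by (intro mult_left_mono exp_ge_add_one_self) auto
  finally have "(\<Sum>S\<in>?U. exp (l * of_bool (j \<in> S))) / C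
      \<le> exp ((exp l - 1) * (real d / real (card M)))"
    using C by (simp add: field_simps)
  then show ?thesis
    using subsets_pmf_facts[OF M(1) d(2)] by (subst integral_pmf_of_set) (simp_all add: C_def)
qed

text \<open>For negative \<open>y = -z\<close> the bound follows from
  \<open>exp (-z) \<le> 1 / (1 + z)\<close> and the identity
  \<open>(1 - z + z^2) (1 + z) = 1 + z^3\<close>.\<close>

lemma exp_le_quadratic:
  fixes y :: real
  assumes "\<bar>y\<bar> \<le> 1"
  shows "exp y \<le> 1 + y + y\<^sup>2"
proof (cases "0 \<le> y")
  case True
  then show ?thesis using exp_bound[of y] assms by simp
next
  case False
  define z where "z = - y"
  have z: "0 \<le> z" "z \<le> 1" using False assms by (auto simp: z_def)
  have "exp (- z) = 1 / exp z" by (simp add: exp_minus field_simps)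
  also have "\<dots> \<le> 1 / (1 + z)"
    using z exp_ge_add_one_self[of z] by (intro divide_left_mono) auto
  also have "\<dots> \<le> 1 - z + z\<^sup>2"
  proof -
    have "(1 - z + z\<^sup>2) * (1 + z) = 1 + z ^ 3"
      by (simp add: algebra_simps power2_eq_square power3_eq_cube)
    then show ?thesis using z by (simp add: divide_simps)
  qed
  finally show ?thesis by (simp add: z_def)
qed

text \<open>After the quadratic bound on \<open>exp\<close> the linear terms cancel, as the variable
  is centred, and the variance \<open>p (1 - p)\<close> is at most 1.\<close>

lemma expectation_bernoulli_exp_le:
  fixes l p :: real
  assumes "0 \<le> p" "p \<le> 1" "\<bar>l\<bar> \<le> 1"
  shows "measure_pmf.expectation (bernoulli_pmf p) (\<lambda>b. exp (l * (of_bool b - p))) \<le> exp (l\<^sup>2)"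
proof -
  have 1: "\<bar>l * (1 - p)\<bar> \<le> 1" "\<bar>l * (0 - p)\<bar> \<le> 1"
    using assms mult_mono[of "\<bar>l\<bar>" 1 "1 - p" 1] mult_mono[of "\<bar>l\<bar>" 1 p 1] by (auto simp: abs_mult)
  have "measure_pmf.expectation (bernoulli_pmf p) (\<lambda>b. exp (l * (of_bool b - p)))
     = p * exp (l * (1 - p)) + (1 - p) * exp (l * (0 - p))"
    using assms by simp
  also have "\<dots> \<le> p * (1 + l * (1 - p) + (l * (1 - p))\<^sup>2) + (1 - p) * (1 + l * (0 - p) + (l * (0 - p))\<^sup>2)"
    using assms 1 by (intro add_mono mult_left_mono exp_le_quadratic) auto
  also have "\<dots> = 1 + l\<^sup>2 * (p * (1 - p))"
    by (simp add: algebra_simps power2_eq_square)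
  also have "\<dots> \<le> 1 + l\<^sup>2 * 1"
    using assms mult_mono[of p 1 "1 - p" 1] by (intro add_left_mono mult_left_mono) auto
  also have "\<dots> \<le> exp (l\<^sup>2)" using exp_ge_add_one_self[of "l\<^sup>2"] by simp
  finally show ?thesis .
qed

subsection \<open>The random bipartite graph\<close>

definition edge_count :: "(nat \<times> nat) set \<Rightarrow> nat set \<Rightarrow> nat set \<Rightarrow> nat" where
  "edge_count E A B = card (E \<inter> A \<times> B)"

definition right_deg :: "nat \<Rightarrow> nat \<Rightarrow> nat \<Rightarrow> real" where
  "right_deg n m d = real n / real m * real d"

text \<open>If \<open>B\<close> receives almost all of the \<open>d |A|\<close> edges at \<open>A\<close>, then either \<open>B\<close> is more than half of
  the right side, or the second term of the edge bound forces \<open>|B|\<close> to exceed \<open>|A|\<close> by a factor of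
  order \<open>d / ln (n + m)\<close>. The constant \<open>7/4\<close> can be any number between \<open>e - 1\<close> (Chernoff's bound with
  parameter \<open>1\<close>) and \<open>2\<close>.\<close>

definition good_graph :: "nat \<Rightarrow> nat \<Rightarrow> nat \<Rightarrow> (nat \<times> nat) set \<Rightarrow> bool" where
  "good_graph n m d E \<longleftrightarrow>
     E \<subseteq> {1..n} \<times> {n+1..n+m} \<and>
     (\<forall>i\<in>{1..n}. edge_count E {i} {n+1..n+m} = d) \<and>
     (\<forall>j\<in>{n+1..n+m}. 63/64 * right_deg n m d \<le> edge_count E {1..n} {j} \<and>
        edge_count E {1..n} {j} \<le> 2 * right_deg n m d) \<and>
     (\<forall>A\<subseteq>{1..n}. \<forall>B\<subseteq>{n+1..n+m}.
        edge_count E A B \<le> 7/4 * real (card A) * real (card B) * real d / real m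
          + 4 * (real (card A) + real (card B)) * ln (real (n + m)))"

lemma exp_1_le: "exp 1 \<le> (11 / 4 :: real)"
  using e_less_272 by simp

lemma edge_count_Sigma:
  assumes "A \<subseteq> {1..n}" "finite B"
  shows "edge_count (SIGMA i:{1..n}. nb i) A B = (\<Sum>i\<in>A. card (nb i \<inter> B))"
proof -
  have "(SIGMA i:{1..n}. nb i) \<inter> A \<times> B = (SIGMA i:A. nb i \<inter> B)"
    using assms by auto
  then show ?thesis
    unfolding edge_count_def using assms by (simp add: finite_subset)
qed

context
  fixes n m d :: nat
  assumes nm: "1 \<le> n" "n \<le> m" and d: "1 \<le> d" "d \<le> m"
begin

private abbreviation (input) "nbs \<equiv> {S. S \<subseteq> {n+1..n+m} \<and> card S = d}"
private abbreviation (input) "nb_pmf \<equiv> Pi_pmf {1..n} {} (\<lambda>_. pmf_of_set nbs)"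

lemma nbs_facts: "nbs \<noteq> {}" "finite nbs"
  using subsets_pmf_facts[of "{n+1..n+m}" d] d by auto

lemma finite_set_nbs: "finite (set_pmf (pmf_of_set nbs))"
  using nbs_facts by (simp add: set_pmf_of_set)

lemma set_nb_pmf:
  assumes "nb \<in> set_pmf nb_pmf" "i \<in> {1..n}"
  shows "nb i \<subseteq> {n+1..n+m}" "card (nb i) = d"
proof -
  have "nb i \<in> set_pmf (pmf_of_set nbs)"
    using assms set_Pi_pmf[of "{1..n}" "{}" "\<lambda>_. pmf_of_set nbs"]
    by (auto simp: PiE_dflt_def)
  then have "nb i \<in> nbs" using nbs_facts by (simp add: set_pmf_of_set)
  then show "nb i \<subseteq> {n+1..n+m}" "card (nb i) = d" by auto
qed

text \<open>Chernoff's bound with parameter 1, applied to the independent neighbourhoods of the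
  vertices in \<open>A\<close>; the constant \<open>7/4\<close> is an upper bound for
  \<open>e - 1\<close>.\<close>

lemma prob_edge_count_ge:
  assumes "A \<subseteq> {1..n}" "B \<subseteq> {n+1..n+m}"
  shows "measure_pmf.prob nb_pmf {nb. t \<le> real (edge_count (SIGMA i:{1..n}. nb i) A B)}
    \<le> exp (7/4 * real (card A) * real (card B) * real d / real m - t)"
proof -
  let ?b = "(exp 1 - 1) * real d * real (card B) / real m"
  have finB: "finite B" using assms finite_subset by auto
  have "measure_pmf.prob nb_pmf {nb. t \<le> (\<Sum>i\<in>A. real (card (nb i \<inter> B)))}
      \<le> exp (- t) * (\<Prod>i\<in>A. exp ?b)"
  proof (rule Pi_pmf_chernoff)
    fix x
    have "measure_pmf.expectation (pmf_of_set nbs) (\<lambda>S. exp 1 ^ card (S \<inter> B)) \<le> exp ?b"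
      using expectation_subsets_power_card_Int_le[of "{n+1..n+m}" B d "exp 1"] assms d by simp
    then show "measure_pmf.expectation (pmf_of_set nbs) (\<lambda>S. exp (real (card (S \<inter> B)))) \<le> exp ?b"
      by (simp add: exp_of_nat_mult[symmetric])
  qed (use assms finite_set_nbs in auto)
  also have "exp (- t) * (\<Prod>i\<in>A. exp ?b) = exp (real (card A) * ?b - t)"
    unfolding prod_constant exp_of_nat_mult[symmetric] by (simp add: exp_diff exp_minus divide_inverse)
  also have "\<dots> \<le> exp (7/4 * real (card A) * real (card B) * real d / real m - t)"
  proof -
    have "(exp 1 - 1) * (real (card A) * real (card B) * real d / real m)
        \<le> 7/4 * (real (card A) * real (card B) * real d / real m)"
      using exp_1_le by (intro mult_right_mono) auto
    then show ?thesis by (simp add: mult_ac)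
  qed
  finally show ?thesis
    unfolding edge_count_Sigma[OF assms(1) finB] of_nat_sum .
qed

lemma prob_right_deg:
  assumes "j \<in> {n+1..n+m}" "\<bar>l\<bar> \<le> 1"
  shows "measure_pmf.prob nb_pmf {nb. t \<le> l * real (edge_count (SIGMA i:{1..n}. nb i) {1..n} {j})}
    \<le> exp ((exp l - 1) * right_deg n m d - t)"
proof -
  let ?b = "(exp l - 1) * real d / real m"
  have "measure_pmf.prob nb_pmf {nb. t \<le> (\<Sum>i\<in>{1..n}. l * of_bool (j \<in> nb i))}
      \<le> exp (- t) * (\<Prod>i\<in>{1..n}. exp ?b)"
    using assms d finite_set_nbs expectation_subsets_exp_mem_le[of "{n+1..n+m}" j d l]
    by (intro Pi_pmf_chernoff) auto
  also have "exp (- t) * (\<Prod>i\<in>{1..n}. exp ?b) = exp ((exp l - 1) * right_deg n m d - t)"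
    by (simp add: right_deg_def exp_diff exp_minus exp_of_nat_mult[symmetric] field_simps)
  finally have *: "measure_pmf.prob nb_pmf {nb. t \<le> (\<Sum>i\<in>{1..n}. l * of_bool (j \<in> nb i))}
    \<le> exp ((exp l - 1) * right_deg n m d - t)" .
  have "(\<Sum>i\<in>{1..n}. l * of_bool (j \<in> nb i)) =
      l * real (edge_count (SIGMA i:{1..n}. nb i) {1..n} {j})" for nb :: "nat \<Rightarrow> nat set"
  proof -
    have "of_bool (j \<in> nb i) = real (card (nb i \<inter> {j}))" for i by auto
    then show ?thesis
      using edge_count_Sigma[of "{1..n}" n "{j}" nb] by (simp add: sum_distrib_left)
  qed
  then show ?thesis using * by (simp only:)
qed

text \<open>A union bound over all pairs of vertex sets and all right vertices. A pair
  \<open>(A, B)\<close> fails with probability at most \<open>N ^ (-4 (|A| + |B|))\<close>, which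
  beats the number of pairs of these sizes.\<close>

lemma prob_not_good_graph:
  assumes N: "3 \<le> n + m" and D: "65536 * ln (real (n + m)) \<le> right_deg n m d"
  shows "measure_pmf.prob (bipartite_graph_pmf n m d) {E. \<not> good_graph n m d E}
    \<le> 1 / real (n + m) ^ 2"
proof -
  define N where "N = real (n + m)"
  define D where "D = right_deg n m d"
  define L where "L = ln N"
  let ?G = "\<lambda>nb. SIGMA i:{1..n}. nb i"
  \<comment> \<open>Pairs with an empty side span no edges and are left out; for two empty sets the
    bound on the failure probability would be 1.\<close>
  let ?PP = "{A. A \<subseteq> {1..n} \<and> A \<noteq> {}} \<times> {B. B \<subseteq> {n+1..n+m} \<and> B \<noteq> {}}"
  let ?t = "\<lambda>A B. 7/4 * real (card A) * real (card B) * real d / real m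
          + 4 * (real (card A) + real (card B)) * L"
  let ?b1 = "\<lambda>(A, B). {nb. ?t A B \<le> real (edge_count (?G nb) A B)}"
  let ?b2 = "\<lambda>j. {nb. 2 * D \<le> 1 * real (edge_count (?G nb) {1..n} {j})}"
  \<comment> \<open>With parameter \<open>-1/128\<close> the exponent is at most
    \<open>(-1/128 + 1/128^2 + 63/8192) D = -D/16384\<close>. For this to be at most
    \<open>-4 L\<close>, one needs \<open>D \<ge> 65536 L\<close>.\<close>
  let ?b3 = "\<lambda>j. {nb. - (1/128) * (63/64 * D) \<le> (- (1/128)) * real (edge_count (?G nb) {1..n} {j})}"
  let ?bad = "(\<Union>p\<in>?PP. ?b1 p) \<union> (\<Union>j\<in>{n+1..n+m}. ?b2 j) \<union> (\<Union>j\<in>{n+1..n+m}. ?b3 j)"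
  have N3: "3 \<le> N" using N by (simp add: N_def)
  have L0: "0 < L" using N3 by (simp add: L_def)
  have D_ge: "65536 * L \<le> D" using D by (simp add: D_def L_def N_def)
  have expL: "exp (- 4 * L) = 1 / N ^ 4"
  proof -
    have "exp (4 * L) = exp L ^ 4" using exp_of_nat_mult[of 4 L] by simp
    then show ?thesis using N3 by (simp add: exp_minus L_def divide_simps)
  qed
  have fin: "finite {A. A \<subseteq> {1..n} \<and> A \<noteq> {}}" "finite {B. B \<subseteq> {n+1..n+m} \<and> B \<noteq> {}}"
    by auto
  have sub: "measure_pmf.prob nb_pmf {nb. \<not> good_graph n m d (?G nb)} \<le> measure_pmf.prob nb_pmf ?bad"
  proof (rule measure_pmf.finite_measure_mono_AE)
    \<comment> \<open>The inclusion of events holds only on the support: the neighbourhoods lie in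
      the right side and have size \<open>d\<close> almost surely, not for every function
      \<open>nb\<close>.\<close>
    show "AE nb in measure_pmf nb_pmf. nb \<in> {nb. \<not> good_graph n m d (?G nb)} \<longrightarrow> nb \<in> ?bad"
    proof (intro AE_pmfI impI, rule ccontr)
      fix nb assume nb: "nb \<in> set_pmf nb_pmf" and ng: "nb \<in> {nb. \<not> good_graph n m d (?G nb)}"
        and nbad: "nb \<notin> ?bad"
      note s = set_nb_pmf[OF nb]
      have 1: "?G nb \<subseteq> {1..n} \<times> {n+1..n+m}" using s(1) by blast
      have 2: "edge_count (?G nb) {i} {n+1..n+m} = d" if "i \<in> {1..n}" for i
      proof -
        have "nb i \<inter> {n+1..n+m} = nb i" using s(1)[OF that] by auto
        then show ?thesis using that s(2)[OF that] edge_count_Sigma[of "{i}" n "{n+1..n+m}" nb] by simp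
      qed
      have 3: "63/64 * right_deg n m d \<le> edge_count (?G nb) {1..n} {j} \<and>
        edge_count (?G nb) {1..n} {j} \<le> 2 * right_deg n m d" if "j \<in> {n+1..n+m}" for j
      proof -
        have "nb \<notin> ?b2 j" "nb \<notin> ?b3 j" using nbad that by (meson UN_I UnI1 UnI2)+
        then show ?thesis by (simp add: D_def not_le)
      qed
      have 4: "edge_count (?G nb) A B \<le> 7/4 * real (card A) * real (card B) * real d / real m
          + 4 * (real (card A) + real (card B)) * ln (real (n + m))"
        if "A \<subseteq> {1..n}" "B \<subseteq> {n+1..n+m}" for A B
      proof (cases "A = {} \<or> B = {}")
        case True
        then have "edge_count (?G nb) A B = 0" by (auto simp: edge_count_def)
        then show ?thesis using L0 by (simp add: L_def N_def)
      next
        case False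
        then have "(A, B) \<in> ?PP" using that by simp
        then have "nb \<notin> ?b1 (A, B)" using nbad by (meson UN_I UnI1)
        then show ?thesis by (simp add: not_le L_def N_def)
      qed
      have "good_graph n m d (?G nb)"
        unfolding good_graph_def using 1 2 3 4 by blast
      then show False using ng by simp
    qed
  qed simp
  define x where "x = 1 / N ^ 4"
  have x0: "0 \<le> x" using N3 by (simp add: x_def)
  have expx: "exp (- 4 * real k * L) = x ^ k" for k :: nat
    using exp_of_nat_mult[of k "- 4 * L"] expL by (simp add: x_def mult_ac)
  have p1: "measure_pmf.prob nb_pmf (?b1 p) \<le> x ^ card (fst p) * x ^ card (snd p)" if "p \<in> ?PP" for p
  proof -
    obtain A B where p: "p = (A, B)" by (cases p)
    have "measure_pmf.prob nb_pmf (?b1 p) \<le> exp (- 4 * real (card A + card B) * L)"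
      using prob_edge_count_ge[of A B "?t A B"] that by (simp add: p algebra_simps)
    then show ?thesis unfolding expx by (simp add: p power_add)
  qed
  \<comment> \<open>Without the empty set the sum is \<open>(1 + x) ^ card I - 1\<close>, which is
    of order \<open>card I * x\<close> because \<open>card I * x\<close> is at most
    \<open>N ^ (-3)\<close>.\<close>
  have sumx: "(\<Sum>A | A \<subseteq> I \<and> A \<noteq> {}. x ^ card A) \<le> 2 * real (card I) * x"
    if "finite I" "real (card I) \<le> N" for I :: "nat set"
  proof -
    have "{A. A \<subseteq> I \<and> A \<noteq> {}} = Pow I - {{}}" by auto
    then have "(\<Sum>A | A \<subseteq> I \<and> A \<noteq> {}. x ^ card A) = (1 + x) ^ card I - 1"
      using that sum_Pow_power_card[of I x] by (simp add: sum_diff1)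
    also have "(1 + x) ^ card I \<le> exp x ^ card I"
      using x0 by (intro power_mono exp_ge_add_one_self) auto
    also have "exp x ^ card I = exp (real (card I) * x)" by (simp add: exp_of_nat_mult)
    also have "exp (real (card I) * x) - 1 \<le> 2 * real (card I) * x"
    proof -
      define y where "y = real (card I) * x"
      have "y \<le> N * x" using that x0 by (simp add: y_def mult_right_mono)
      also have "N * x = 1 / N ^ 3" using N3 by (simp add: x_def field_simps power_numeral_reduce)
      also have "\<dots> \<le> 1" using N3 by (simp add: one_le_power)
      finally have y: "0 \<le> y" "y \<le> 1" using x0 by (simp_all add: y_def)
      then have "exp y \<le> 1 + y + y\<^sup>2" by (intro exp_bound)
      also have "y\<^sup>2 \<le> y" using y by (simp add: power2_eq_square mult_left_le)
      finally show ?thesis by (simp add: y_def mult_ac)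
    qed
    finally show ?thesis by simp
  qed
  have P1: "measure_pmf.prob nb_pmf (\<Union>p\<in>?PP. ?b1 p) \<le> 4 / N ^ 6"
  proof -
    have "measure_pmf.prob nb_pmf (\<Union>p\<in>?PP. ?b1 p) \<le> (\<Sum>p\<in>?PP. measure_pmf.prob nb_pmf (?b1 p))"
      using fin by (intro measure_pmf.finite_measure_subadditive_finite) auto
    also have "\<dots> \<le> (\<Sum>p\<in>?PP. x ^ card (fst p) * x ^ card (snd p))"
      by (intro sum_mono p1)
    also have "\<dots> = (\<Sum>A | A \<subseteq> {1..n} \<and> A \<noteq> {}. x ^ card A) * (\<Sum>A | A \<subseteq> {n+1..n+m} \<and> A \<noteq> {}. x ^ card A)"
      by (simp add: sum_product sum.cartesian_product case_prod_beta)
    also have "\<dots> \<le> (2 * real n * x) * (2 * real m * x)"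
      using sumx[of "{1..n}"] sumx[of "{n+1..n+m}"] x0
      by (intro mult_mono sum_nonneg) (auto simp: N_def)
    also have "\<dots> \<le> (2 * N * x) * (2 * N * x)"
      using x0 by (intro mult_mono) (auto simp: N_def)
    also have "\<dots> = 4 / N ^ 6" using N3 by (simp add: x_def field_simps power_numeral_reduce)
    finally show ?thesis .
  qed
  have P2: "measure_pmf.prob nb_pmf (\<Union>j\<in>{n+1..n+m}. ?b2 j) \<le> 1 / N ^ 3"
  proof -
    have "measure_pmf.prob nb_pmf (\<Union>j\<in>{n+1..n+m}. ?b2 j) \<le> (\<Sum>j\<in>{n+1..n+m}. measure_pmf.prob nb_pmf (?b2 j))"
      by (intro measure_pmf.finite_measure_subadditive_finite) auto
    also have "\<dots> \<le> (\<Sum>j\<in>{n+1..n+m}. 1 / N ^ 4)"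
    proof (rule sum_mono)
      fix j assume j: "j \<in> {n+1..n+m}"
      have "measure_pmf.prob nb_pmf (?b2 j) \<le> exp ((exp 1 - 1) * D - 2 * D)"
        using prob_right_deg[OF j, of 1 "2 * D"] by (simp add: D_def)
      \<comment> \<open>The exponent is \<open>(e - 3) D\<close>, at most
        \<open>-D/4\<close>.\<close>
      also have "\<dots> \<le> exp (- 4 * L)"
      proof -
        have "exp 1 * D \<le> 11/4 * D" using D_ge L0 by (intro mult_right_mono exp_1_le) auto
        moreover have "(exp 1 - 1) * D - 2 * D = exp 1 * D - 3 * D" by (simp add: algebra_simps)
        ultimately show ?thesis unfolding exp_le_cancel_iff using D_ge L0 by linarith
      qed
      finally show "measure_pmf.prob nb_pmf (?b2 j) \<le> 1 / N ^ 4" using expL by simp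
    qed
    also have "\<dots> \<le> N * (1 / N ^ 4)" unfolding sum_constant
      using N3 by (intro mult_right_mono) (auto simp: N_def)
    also have "\<dots> = 1 / N ^ 3" using N3 by (simp add: field_simps power_numeral_reduce)
    finally show ?thesis .
  qed
  have P3: "measure_pmf.prob nb_pmf (\<Union>j\<in>{n+1..n+m}. ?b3 j) \<le> 1 / N ^ 3"
  proof -
    have "measure_pmf.prob nb_pmf (\<Union>j\<in>{n+1..n+m}. ?b3 j) \<le> (\<Sum>j\<in>{n+1..n+m}. measure_pmf.prob nb_pmf (?b3 j))"
      by (intro measure_pmf.finite_measure_subadditive_finite) auto
    also have "\<dots> \<le> (\<Sum>j\<in>{n+1..n+m}. 1 / N ^ 4)"
    proof (rule sum_mono)
      fix j assume j: "j \<in> {n+1..n+m}"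
      have "measure_pmf.prob nb_pmf (?b3 j) \<le> exp ((exp (- (1/128)) - 1) * D - (- (1/128) * (63/64 * D)))"
        using prob_right_deg[OF j, of "- (1/128)" "- (1/128) * (63/64 * D)"] by (simp add: D_def)
      also have "\<dots> \<le> exp (- 4 * L)"
      proof -
        have "exp (- (1/128)) \<le> 1 + - (1/128) + (- (1/128 :: real))\<^sup>2"
          by (rule exp_le_quadratic) auto
        then have "(exp (- (1/128)) - 1) * D \<le> (- (1/128) + (- (1/128))\<^sup>2) * D"
          using D_ge L0 by (intro mult_right_mono) auto
        then show ?thesis using D_ge by (simp add: power2_eq_square)
      qed
      finally show "measure_pmf.prob nb_pmf (?b3 j) \<le> 1 / N ^ 4" using expL by simp
    qed
    also have "\<dots> \<le> N * (1 / N ^ 4)" unfolding sum_constant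
      using N3 by (intro mult_right_mono) (auto simp: N_def)
    also have "\<dots> = 1 / N ^ 3" using N3 by (simp add: field_simps power_numeral_reduce)
    finally show ?thesis .
  qed
  have "measure_pmf.prob nb_pmf ?bad \<le> measure_pmf.prob nb_pmf (\<Union>p\<in>?PP. ?b1 p) +
      measure_pmf.prob nb_pmf (\<Union>j\<in>{n+1..n+m}. ?b2 j) + measure_pmf.prob nb_pmf (\<Union>j\<in>{n+1..n+m}. ?b3 j)"
    by (intro order_trans[OF measure_Un_le] add_mono order_refl) auto
  also have "\<dots> \<le> 4 / N ^ 6 + 1 / N ^ 3 + 1 / N ^ 3"
    by (intro add_mono P1 P2 P3)
  also have "\<dots> \<le> 1 / N ^ 2"
  proof -
    have "4 + 2 * N ^ 3 \<le> N ^ 4"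
    proof -
      have "27 \<le> N ^ 3" using power_mono[OF N3, of 3] by simp
      moreover have "3 * N ^ 3 \<le> N * N ^ 3" using N3 by (intro mult_right_mono) auto
      ultimately show ?thesis by (simp add: power_numeral_reduce)
    qed
    moreover have "4 / N ^ 6 + 1 / N ^ 3 + 1 / N ^ 3 = (4 + 2 * N ^ 3) / N ^ 6"
      using N3 by (simp add: field_simps power_numeral_reduce)
    moreover have "1 / N ^ 2 = N ^ 4 / N ^ 6" using N3 by (simp add: field_simps power_numeral_reduce)
    ultimately show ?thesis using N3 by (simp add: divide_right_mono)
  qed
  finally show ?thesis
    using sub unfolding bipartite_graph_pmf_def by (simp add: N_def vimage_def)
qed

end

subsection \<open>Comparison noise\<close>

lemma logistic_pos: "0 < logistic x"
  and logistic_less_1: "logistic x < 1"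
  by (auto simp: logistic_def add_pos_pos)

lemma logistic_minus: "logistic (- x) = 1 - logistic x"
  by (simp add: logistic_def exp_minus divide_simps add_pos_pos add_nonneg_eq_0_iff)

text \<open>The score: the partial derivative of the log-likelihood at \<open>u\<close> in
  coordinate \<open>i\<close>, that is, the wins of \<open>i\<close> minus their conditional
  expectation given the graph. The term \<open>j = i\<close> vanishes since
  \<open>logistic 0 = 1/2\<close>.\<close>

definition noise :: "nat \<Rightarrow> (nat \<Rightarrow> nat \<Rightarrow> real) \<Rightarrow> (nat \<Rightarrow> real) \<Rightarrow> nat \<Rightarrow> real" where
  "noise N A u i = (\<Sum>j\<in>{1..N}. A i j - (A i j + A j i) * logistic (u i - u j))"

text \<open>The expected degree of \<open>i\<close>. Using it in place of the random degree makes
  the volume of a set depend only on its numbers of left and right vertices.\<close>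

definition vweight :: "nat \<Rightarrow> nat \<Rightarrow> nat \<Rightarrow> nat \<Rightarrow> real" where
  "vweight n m d i = (if i \<le> n then real d else right_deg n m d)"

lemma prob_comparison_sum_ge:
  assumes "finite E" "F \<subseteq> E" "\<bar>l\<bar> \<le> 1"
  shows "measure_pmf.prob (comparison_pmf u E)
      {w. s \<le> l * (\<Sum>e\<in>F. of_bool (w e) - logistic (u (fst e) - u (snd e)))}
    \<le> exp (l\<^sup>2 * real (card F) - s)"
proof -
  let ?p = "\<lambda>e. logistic (u (fst e) - u (snd e))"
  have p: "0 \<le> ?p e" "?p e \<le> 1" for e
    using logistic_pos logistic_less_1 by (auto intro: less_imp_le)
  have "measure_pmf.prob (Pi_pmf E False (\<lambda>e. bernoulli_pmf (?p e)))
      {w. s \<le> (\<Sum>e\<in>F. l * (of_bool (w e) - ?p e))} \<le> exp (- s) * (\<Prod>e\<in>F. exp (l\<^sup>2))"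
    using assms expectation_bernoulli_exp_le[OF p assms(3)]
    by (intro Pi_pmf_chernoff) (auto intro: finite_subset[OF subset_UNIV])
  also have "exp (- s) * (\<Prod>e\<in>F. exp (l\<^sup>2)) = exp (l\<^sup>2 * real (card F) - s)"
    unfolding prod_constant exp_of_nat_mult[symmetric]
    by (simp add: exp_diff exp_minus divide_inverse mult_ac)
  finally show ?thesis
    unfolding comparison_pmf_def by (simp add: sum_distrib_left case_prod_unfold)
qed

lemma noise_left:
  assumes E: "E \<subseteq> {1..n} \<times> {n+1..n+m}" and i: "i \<in> {1..n}"
  shows "noise (n + m) (win_matrix E w) u i =
    (\<Sum>e\<in>E \<inter> {i} \<times> {n+1..n+m}. of_bool (w e) - logistic (u (fst e) - u (snd e)))"
proof -
  let ?h = "\<lambda>e. of_bool (w e) - logistic (u (fst e) - u (snd e)) :: real"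
  have nE: "(j, i) \<notin> E" for j using E i by auto
  have "noise (n + m) (win_matrix E w) u i = (\<Sum>j\<in>{1..n+m}. if (i, j) \<in> E then ?h (i, j) else 0)"
    unfolding noise_def using nE by (intro sum.cong) (auto simp: win_matrix_def)
  also have "\<dots> = (\<Sum>j\<in>{j\<in>{1..n+m}. (i, j) \<in> E}. ?h (i, j))"
    by (intro sum.mono_neutral_cong_right) auto
  also have "\<dots> = (\<Sum>e\<in>E \<inter> {i} \<times> {n+1..n+m}. ?h e)"
    using E by (intro sum.reindex_bij_witness[where i = snd and j = "Pair i"]) auto
  finally show ?thesis .
qed

text \<open>Outcomes record wins of the left endpoint, hence the minus sign.\<close>

lemma noise_right:
  assumes E: "E \<subseteq> {1..n} \<times> {n+1..n+m}" and j: "j \<in> {n+1..n+m}"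
  shows "noise (n + m) (win_matrix E w) u j =
    - (\<Sum>e\<in>E \<inter> {1..n} \<times> {j}. of_bool (w e) - logistic (u (fst e) - u (snd e)))"
proof -
  let ?h = "\<lambda>e. of_bool (w e) - logistic (u (fst e) - u (snd e)) :: real"
  have nE: "(j, i) \<notin> E" for i using E j by auto
  have lm: "logistic (u j - u i) = 1 - logistic (u i - u j)" for i
    using logistic_minus[of "u i - u j"] by simp
  have "noise (n + m) (win_matrix E w) u j = (\<Sum>i\<in>{1..n+m}. if (i, j) \<in> E then - ?h (i, j) else 0)"
    unfolding noise_def using nE by (intro sum.cong) (auto simp: win_matrix_def lm)
  also have "\<dots> = (\<Sum>i\<in>{i\<in>{1..n+m}. (i, j) \<in> E}. - ?h (i, j))"
    by (intro sum.mono_neutral_cong_right) auto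
  also have "\<dots> = (\<Sum>e\<in>E \<inter> {1..n} \<times> {j}. - ?h e)"
    using E by (intro sum.reindex_bij_witness[where i = fst and j = "\<lambda>i. (i, j)"]) auto
  finally show ?thesis by (simp only: sum_negf)
qed

text \<open>Chernoff's bound with parameters \<open>\<epsilon>\<close> and
  \<open>-\<epsilon>\<close>. Degrees are at most twice the weight, so the exponent is at most
  \<open>2 \<epsilon>^2 w - 6 \<epsilon>^2 w = -4 \<epsilon>^2 w\<close>, where \<open>w\<close> is
  the weight. As \<open>w\<close> is at least the mean right degree, this is at most
  \<open>-4 ln N\<close>, and the union bound over \<open>2 N\<close> events leaves room.\<close>

lemma prob_noise:
  assumes G: "good_graph n m d E" and N: "2 \<le> n + m"
    and D: "0 < right_deg n m d" "right_deg n m d \<le> real d"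
    and eps: "0 < \<epsilon>" "\<epsilon> \<le> 1" "ln (real (n + m)) \<le> \<epsilon>\<^sup>2 * right_deg n m d"
  shows "measure_pmf.prob (comparison_pmf u E)
      {w. \<not> (\<forall>i\<in>{1..n+m}. \<bar>noise (n + m) (win_matrix E w) u i\<bar> \<le> 6 * \<epsilon> * vweight n m d i)}
    \<le> 1 / real (n + m) ^ 2"
proof -
  let ?P = "comparison_pmf u E"
  define N where "N = real (n + m)"
  define F where "F i = (if i \<le> n then E \<inter> {i} \<times> {n+1..n+m} else E \<inter> {1..n} \<times> {i})" for i
  define z where "z w i = (\<Sum>e\<in>F i. of_bool (w e) - logistic (u (fst e) - u (snd e)))"
    for w :: "nat \<times> nat \<Rightarrow> bool" and i
  let ?s = "\<lambda>i. 6 * \<epsilon>\<^sup>2 * vweight n m d i"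
  let ?b = "\<lambda>i. {w. ?s i \<le> \<epsilon> * z w i} \<union> {w. ?s i \<le> (- \<epsilon>) * z w i}"
  have E: "E \<subseteq> {1..n} \<times> {n+1..n+m}" using G by (simp add: good_graph_def)
  have finE: "finite E" using E finite_subset by blast
  have N2: "2 \<le> N" using N by (simp add: N_def)
  have noise_eq: "\<bar>noise (n + m) (win_matrix E w) u i\<bar> = \<bar>z w i\<bar>" if "i \<in> {1..n+m}" for w i
  proof (cases "i \<le> n")
    case True
    then have "i \<in> {1..n}" using that by simp
    from noise_left[OF E this] True show ?thesis by (simp add: z_def F_def)
  next
    case False
    then have "i \<in> {n+1..n+m}" using that by simp
    from noise_right[OF E this] False show ?thesis by (simp add: z_def F_def)
  qed
  have cardF: "real (card (F i)) \<le> 2 * vweight n m d i" if "i \<in> {1..n+m}" for i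
  proof (cases "i \<le> n")
    case True
    then have "i \<in> {1..n}" using that by simp
    then have "edge_count E {i} {n+1..n+m} = d" using G unfolding good_graph_def by blast
    then show ?thesis using True by (simp add: F_def vweight_def edge_count_def)
  next
    case False
    then have "i \<in> {n+1..n+m}" using that by simp
    then have "edge_count E {1..n} {i} \<le> 2 * right_deg n m d" using G unfolding good_graph_def by blast
    then show ?thesis using False by (simp add: F_def vweight_def edge_count_def)
  qed
  have tail: "measure_pmf.prob ?P {w. ?s i \<le> l * z w i} \<le> 1 / N ^ 4"
    if i: "i \<in> {1..n+m}" and l: "\<bar>l\<bar> = \<epsilon>" for l i
  proof -
    have l2: "l\<^sup>2 = \<epsilon>\<^sup>2" using l by (metis power2_abs)
    have Fi: "F i \<subseteq> E" by (auto simp: F_def)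
    have "measure_pmf.prob ?P {w. ?s i \<le> l * z w i} \<le> exp (l\<^sup>2 * real (card (F i)) - ?s i)"
      unfolding z_def using l eps by (intro prob_comparison_sum_ge finE Fi) auto
    also have "\<dots> \<le> exp (- 4 * ln N)"
    proof -
      have "\<epsilon>\<^sup>2 * real (card (F i)) \<le> \<epsilon>\<^sup>2 * (2 * vweight n m d i)"
        using cardF[OF i] by (intro mult_left_mono) auto
      moreover have "ln N \<le> \<epsilon>\<^sup>2 * vweight n m d i"
      proof -
        have "\<epsilon>\<^sup>2 * right_deg n m d \<le> \<epsilon>\<^sup>2 * vweight n m d i"
          using D by (intro mult_left_mono) (auto simp: vweight_def)
        then show ?thesis using eps(3) unfolding N_def by linarith
      qed
      ultimately show ?thesis by (simp add: l2)
    qed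
    also have "\<dots> = 1 / N ^ 4"
    proof -
      have "exp (4 * ln N) = exp (ln N) ^ 4" using exp_of_nat_mult[of 4 "ln N"] by simp
      then show ?thesis using N2 by (simp add: exp_minus divide_simps)
    qed
    finally show ?thesis .
  qed
  have "measure_pmf.prob ?P {w. \<not> (\<forall>i\<in>{1..n+m}. \<bar>noise (n + m) (win_matrix E w) u i\<bar> \<le> 6 * \<epsilon> * vweight n m d i)}
      \<le> measure_pmf.prob ?P (\<Union>i\<in>{1..n+m}. ?b i)"
  proof (rule measure_pmf.finite_measure_mono)
    show "{w. \<not> (\<forall>i\<in>{1..n+m}. \<bar>noise (n + m) (win_matrix E w) u i\<bar> \<le> 6 * \<epsilon> * vweight n m d i)}
        \<subseteq> (\<Union>i\<in>{1..n+m}. ?b i)"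
    proof
      fix w assume "w \<in> {w. \<not> (\<forall>i\<in>{1..n+m}. \<bar>noise (n + m) (win_matrix E w) u i\<bar> \<le> 6 * \<epsilon> * vweight n m d i)}"
      then obtain i where i: "i \<in> {1..n+m}" and gt: "6 * \<epsilon> * vweight n m d i < \<bar>z w i\<bar>"
        using noise_eq by force
      have "\<epsilon> * (6 * \<epsilon> * vweight n m d i) \<le> \<epsilon> * \<bar>z w i\<bar>"
        using gt eps by (intro mult_left_mono) auto
      then have "w \<in> ?b i"
        by (cases "0 \<le> z w i") (auto simp: power2_eq_square algebra_simps)
      then show "w \<in> (\<Union>i\<in>{1..n+m}. ?b i)" using i by blast
    qed
  qed simp
  also have "\<dots> \<le> (\<Sum>i\<in>{1..n+m}. measure_pmf.prob ?P (?b i))"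
    by (intro measure_pmf.finite_measure_subadditive_finite) auto
  also have "\<dots> \<le> (\<Sum>i\<in>{1..n+m}. 1 / N ^ 4 + 1 / N ^ 4)"
    using tail[of _ \<epsilon>] tail[of _ "- \<epsilon>"] eps(1)
    by (intro sum_mono order_trans[OF measure_Un_le] add_mono) simp_all
  also have "\<dots> = N * (2 / N ^ 4)" by (simp add: N_def)
  also have "\<dots> = 2 / N ^ 3"
    using N2 by (simp add: field_simps power_numeral_reduce)
  also have "\<dots> \<le> 1 / N ^ 2"
    using N2 by (simp add: field_simps power_numeral_reduce)
  finally show ?thesis by (simp add: N_def)
qed

text \<open>Conditioning on the first stage: its failure probability is bounded by the indicator of
  a bad \<open>x\<close> plus \<open>b\<close>.\<close>

lemma prob_bind_pmf_not_le:
  assumes P: "measure_pmf.prob p {x. \<not> Q x} \<le> a"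
    and K: "\<And>x. Q x \<Longrightarrow> measure_pmf.prob (K x) {y. \<not> R y} \<le> b" and b: "0 \<le> b"
  shows "1 - (a + b) \<le> measure_pmf.prob (bind_pmf p K) {y. R y}"
proof -
  have "measure_pmf.prob (bind_pmf p K) {y. \<not> R y} =
      measure_pmf.expectation p (\<lambda>x. measure_pmf.prob (K x) {y. \<not> R y})"
    unfolding measure_pmf_bind
    by (subst measure_pmf.measure_bind[where N = "count_space UNIV"]) (auto intro: measure_pmf_in_subprob_algebra)
  also have "\<dots> \<le> measure_pmf.expectation p (\<lambda>x. indicator {x. \<not> Q x} x + b)"
    using K b by (intro integral_mono_AE)
      (auto intro!: measure_pmf.integrable_const_bound[where B = 1]
         measure_pmf.integrable_const_bound[where B = "1 + b"] AE_pmfI order_trans[OF K]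
         simp: indicator_def add_increasing2)
  also have "\<dots> = measure_pmf.prob p {x. \<not> Q x} + b"
    by (subst Bochner_Integration.integral_add)
      (auto intro!: measure_pmf.integrable_const_bound[where B = 1] simp: indicator_def)
  also have "\<dots> \<le> a + b" using P by simp
  finally have "measure_pmf.prob (bind_pmf p K) {y. \<not> R y} \<le> a + b" .
  moreover have "measure_pmf.prob (bind_pmf p K) {y. R y} = 1 - measure_pmf.prob (bind_pmf p K) {y. \<not> R y}"
    using measure_pmf.prob_compl[of "{y. \<not> R y}" "bind_pmf p K"]
    by (simp add: Compl_eq_Diff_UNIV[symmetric] Collect_neg_eq)
  ultimately show ?thesis by simp
qed

subsection \<open>The constrained maximizer\<close>

lemma ln_logistic_deriv:
  "((\<lambda>x. ln (logistic x)) has_real_derivative (1 - logistic x)) (at x)"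
proof -
  have "ln (logistic x) = - ln (1 + exp (- x))" for x
    by (simp add: logistic_def ln_div add_pos_pos)
  moreover have "((\<lambda>x. - ln (1 + exp (- x))) has_real_derivative (1 - logistic x)) (at x)"
    by (auto intro!: derivative_eq_intros simp: add_pos_pos logistic_def field_simps add_nonneg_eq_0_iff)
  ultimately show ?thesis by (simp add: fun_eq_iff)
qed

lemma logistic_deriv:
  "(logistic has_real_derivative (logistic x * logistic (- x))) (at x)"
proof -
  have "((\<lambda>x. 1 / (1 + exp (- x))) has_real_derivative (exp (- x) / (1 + exp (- x))\<^sup>2)) (at x)"
    by (auto intro!: derivative_eq_intros simp: add_nonneg_eq_0_iff power2_eq_square)
  moreover have "exp (- x) / (1 + exp (- x))\<^sup>2 = logistic x * logistic (- x)"
    unfolding logistic_minus by (simp add: logistic_def divide_simps add_nonneg_eq_0_iff power2_eq_square)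
  moreover have "logistic = (\<lambda>x. 1 / (1 + exp (- x)))"
    by (simp add: fun_eq_iff logistic_def)
  ultimately show ?thesis by simp
qed

lemma logistic_strict_mono: "x < y \<Longrightarrow> logistic x < logistic y"
  by (simp add: logistic_def divide_simps add_pos_pos)

lemma logistic_mono: "x \<le> y \<Longrightarrow> logistic x \<le> logistic y"
  using logistic_strict_mono[of x y] by (cases "x = y") auto

text \<open>By the mean value theorem, since the derivative
  \<open>logistic z * logistic (- z)\<close> has both factors at least \<open>logistic (- M)\<close>
  on \<open>[-M, M]\<close>. This constant is the only way in which the merit range enters the error
  bound.\<close>

lemma logistic_diff_ge:
  assumes "\<bar>x\<bar> \<le> M" "\<bar>y\<bar> \<le> M" "y \<le> x"
  shows "(logistic (- M))\<^sup>2 * (x - y) \<le> logistic x - logistic y"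
proof (cases "y = x")
  case False
  then have "y < x" using assms by simp
  then obtain z where z: "y < z" "z < x" "logistic x - logistic y = (x - y) * (logistic z * logistic (- z))"
    using MVT2[of y x logistic "\<lambda>z. logistic z * logistic (- z)"] logistic_deriv by auto
  have "(logistic (- M))\<^sup>2 \<le> logistic z * logistic (- z)"
    unfolding power2_eq_square using z assms logistic_pos
    by (intro mult_mono logistic_mono) (auto intro: less_imp_le)
  then show ?thesis using z \<open>y < x\<close> by (simp add: mult.commute mult_left_mono)
qed simp

text \<open>Strict concavity in tangent form: the derivative \<open>1 - logistic\<close> is strictly
  decreasing.\<close>

lemma ln_logistic_tangent:
  assumes "y \<noteq> x"
  shows "ln (logistic y) < ln (logistic x) + (1 - logistic x) * (y - x)"
proof (cases "x < y")
  case True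
  then obtain z where "x < z" "ln (logistic y) - ln (logistic x) = (y - x) * (1 - logistic z)"
    using MVT2[of x y "\<lambda>x. ln (logistic x)" "\<lambda>z. 1 - logistic z"] ln_logistic_deriv by auto
  moreover have "(y - x) * (1 - logistic z) < (y - x) * (1 - logistic x)"
    using True \<open>x < z\<close> logistic_strict_mono by (intro mult_strict_left_mono) auto
  ultimately show ?thesis by (simp add: mult.commute)
next
  case False
  then have "y < x" using assms by simp
  then obtain z where "z < x" "ln (logistic x) - ln (logistic y) = (x - y) * (1 - logistic z)"
    using MVT2[of y x "\<lambda>x. ln (logistic x)" "\<lambda>z. 1 - logistic z"] ln_logistic_deriv by auto
  moreover have "(x - y) * (1 - logistic x) < (x - y) * (1 - logistic z)"
    using \<open>y < x\<close> \<open>z < x\<close> logistic_strict_mono by (intro mult_strict_left_mono) auto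
  ultimately show ?thesis by (simp add: algebra_simps)
qed

section \<open>Optimality conditions over the constraint set\<close>

definition dir_deriv :: "nat \<Rightarrow> (nat \<Rightarrow> nat \<Rightarrow> real) \<Rightarrow> (nat \<Rightarrow> real) \<Rightarrow> (nat \<Rightarrow> real) \<Rightarrow> real" where
  "dir_deriv N A v h =
     (\<Sum>i\<in>{1..N}. \<Sum>j\<in>{1..N} - {i}. A i j * ((1 - logistic (v i - v j)) * (h i - h j)))"

lemma log_likelihood_deriv:
  "((\<lambda>s. log_likelihood N A (\<lambda>i. v i + s * h i)) has_real_derivative dir_deriv N A v h) (at 0)"
proof -
  have "((\<lambda>s. ln (logistic (v i + s * h i - (v j + s * h j)))) has_real_derivative
      (1 - logistic (v i - v j)) * (h i - h j)) (at 0)" for i j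
  proof (rule DERIV_cong[OF DERIV_chain2[where f = "\<lambda>x. ln (logistic x)"]])
    show "((\<lambda>x. ln (logistic x)) has_real_derivative (1 - logistic (v i - v j)))
        (at (v i + 0 * h i - (v j + 0 * h j)))"
      using ln_logistic_deriv[of "v i - v j"] by simp
    show "((\<lambda>s. v i + s * h i - (v j + s * h j)) has_real_derivative (h i - h j)) (at 0)"
      by (auto intro!: derivative_eq_intros)
  qed simp
  then show ?thesis
    unfolding log_likelihood_def dir_deriv_def by (intro DERIV_sum DERIV_cmult)
qed

text \<open>Only differences of \<open>v - u\<close> are constrained, so this set, like the
  likelihood, is invariant under adding a constant. The bound 1 keeps all \<open>v i - v j\<close>
  within \<open>M + 1\<close>, where the slope of \<open>logistic\<close> is bounded below.\<close>

definition near :: "nat \<Rightarrow> (nat \<Rightarrow> real) \<Rightarrow> (nat \<Rightarrow> real) \<Rightarrow> bool" where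
  "near N u v \<longleftrightarrow> (\<forall>i\<in>{1..N}. \<forall>j\<in>{1..N}. (v i - u i) - (v j - u j) \<le> 1)"

definition near_max :: "nat \<Rightarrow> (nat \<Rightarrow> nat \<Rightarrow> real) \<Rightarrow> (nat \<Rightarrow> real) \<Rightarrow> (nat \<Rightarrow> real) \<Rightarrow> bool" where
  "near_max N A u v \<longleftrightarrow>
     near N u v \<and> (\<forall>x. near N u x \<longrightarrow> log_likelihood N A x \<le> log_likelihood N A v)"

lemma log_likelihood_cong:
  assumes "\<And>i. i \<in> {1..N} \<Longrightarrow> v i = w i + c"
  shows "log_likelihood N A v = log_likelihood N A w"
  unfolding log_likelihood_def using assms by (intro sum.cong refl) auto

text \<open>Exchanging winners and losers while negating merits is a symmetry of the problem. It
  turns statements on upper level sets into statements on lower ones.\<close>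

lemma near_max_uminus:
  assumes "near_max N A u v"
  shows "near_max N (\<lambda>i j. A j i) (\<lambda>i. - u i) (\<lambda>i. - v i)"
proof -
  have L: "log_likelihood N (\<lambda>i j. A j i) (\<lambda>i. - x i) = log_likelihood N A x" for x
  proof -
    have "log_likelihood N (\<lambda>i j. A j i) (\<lambda>i. - x i) =
       (\<Sum>i\<in>{1..N}. \<Sum>j\<in>{1..N}. if j = i then 0 else A j i * ln (logistic (x j - x i)))"
      unfolding log_likelihood_def
      by (rule sum.cong[OF refl], rule sum.mono_neutral_cong_left) auto
    also have "\<dots> = (\<Sum>j\<in>{1..N}. \<Sum>i\<in>{1..N}. if j = i then 0 else A j i * ln (logistic (x j - x i)))"
      by (rule sum.swap)
    also have "\<dots> = log_likelihood N A x"
      unfolding log_likelihood_def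
      by (rule sum.cong[OF refl], rule sum.mono_neutral_cong_right) auto
    finally show ?thesis .
  qed
  have nr: "near N (\<lambda>i. - u i) (\<lambda>i. - x i) \<longleftrightarrow> near N u x" for x
    unfolding near_def by (auto simp: algebra_simps)
  have "log_likelihood N (\<lambda>i j. A j i) x \<le> log_likelihood N (\<lambda>i j. A j i) (\<lambda>i. - v i)"
    if "near N (\<lambda>i. - u i) x" for x
    using that assms nr[of "\<lambda>i. - x i"] L[of "\<lambda>i. - x i"] L[of v] by (simp add: near_max_def)
  then show ?thesis using assms nr by (simp add: near_max_def)
qed

lemma noise_uminus: "noise N (\<lambda>i j. A j i) (\<lambda>i. - u i) i = - noise N A u i"
proof -
  have e: "logistic (- u i - - u j) = 1 - logistic (u i - u j)" for j
    using logistic_minus[of "u i - u j"] by simp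
  have "A j i - (A j i + A i j) * logistic (- u i - - u j) =
      - (A i j - (A i j + A j i) * logistic (u i - u j))" for j
    unfolding e by (simp add: algebra_simps)
  then show ?thesis
    unfolding noise_def sum_negf[symmetric] by (intro sum.cong refl)
qed

text \<open>Lowering the coordinates in an upper level set \<open>S\<close> of \<open>v - u\<close> keeps \<open>v\<close> feasible.\<close>

lemma near_max_cut:
  assumes max: "near_max N A u v" and S: "S \<subseteq> {1..N}"
    and upper: "\<And>i j. i \<in> S \<Longrightarrow> j \<in> {1..N} - S \<Longrightarrow> v j - u j \<le> v i - u i"
  shows "0 \<le> (\<Sum>i\<in>S. \<Sum>j\<in>{1..N} - S. A i j - (A i j + A j i) * logistic (v i - v j))"
proof -
  define h :: "nat \<Rightarrow> real" where "h i = - of_bool (i \<in> S)" for i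
  let ?V = "{1..N}"
  let ?f = "\<lambda>i j. logistic (v i - v j)"
  \<comment> \<open>The move increases only differences from a vertex outside \<open>S\<close> to
    one inside. These are at most 0 before the move, so they stay at most \<open>s\<close>.\<close>
  have near_h: "near N u (\<lambda>i. v i + s * h i)" if "0 < s" "s \<le> 1" for s
    unfolding near_def
  proof (intro ballI)
    fix i j assume ij: "i \<in> {1..N}" "j \<in> {1..N}"
    have "(v i - u i) - (v j - u j) \<le> 1" using max ij by (simp add: near_max_def near_def)
    moreover have "(v i - u i) - (v j - u j) \<le> 0" if "j \<in> S" "i \<notin> S"
      using upper[of j i] that ij by simp
    ultimately show "v i + s * h i - u i - (v j + s * h j - u j) \<le> 1"
      using that by (auto simp: h_def)
  qed
  have le0: "dir_deriv N A v h \<le> 0"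
  proof (rule ccontr)
    assume "\<not> ?thesis"
    then obtain e where e: "0 < e" "\<forall>s>0. s < e \<longrightarrow>
        log_likelihood N A (\<lambda>i. v i + 0 * h i) < log_likelihood N A (\<lambda>i. v i + (0 + s) * h i)"
      using DERIV_pos_inc_right[OF log_likelihood_deriv[of N A v h]] by (auto simp: not_le)
    define s where "s = min e 1 / 2"
    have s: "0 < s" "s < e" "s \<le> 1" using e by (auto simp: s_def min_def)
    then have "log_likelihood N A v < log_likelihood N A (\<lambda>i. v i + s * h i)"
      using e by simp
    moreover have "log_likelihood N A (\<lambda>i. v i + s * h i) \<le> log_likelihood N A v"
      using max near_h[of s] s by (simp add: near_max_def)
    ultimately show False by simp
  qed
  \<comment> \<open>Pairs on the same side of the cut contribute nothing. The two orders of a pair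
    across the cut are then merged, with the end in \<open>S\<close> written first.\<close>
  let ?g = "\<lambda>i j. A i j * ((1 - ?f i j) * (of_bool (i \<in> S) - of_bool (j \<in> S)))"
  have fin: "finite S" using S finite_subset by auto
  have "- dir_deriv N A v h = (\<Sum>i\<in>?V. \<Sum>j\<in>?V. ?g i j)"
    unfolding dir_deriv_def sum_negf[symmetric]
    by (rule sum.cong[OF refl], rule sum.mono_neutral_cong_left) (auto simp: h_def algebra_simps)
  also have "\<dots> = (\<Sum>i\<in>?V - S. \<Sum>j\<in>?V. ?g i j) + (\<Sum>i\<in>S. \<Sum>j\<in>?V. ?g i j)"
    using S by (intro sum.subset_diff) auto
  also have "(\<Sum>i\<in>?V - S. \<Sum>j\<in>?V. ?g i j) = (\<Sum>i\<in>?V - S. \<Sum>j\<in>S. - (A i j * (1 - ?f i j)))"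
    using S by (intro sum.cong[OF refl] sum.mono_neutral_cong_right) (auto simp: algebra_simps)
  also have "\<dots> = (\<Sum>j\<in>S. \<Sum>i\<in>?V - S. - (A i j * (1 - ?f i j)))" by (rule sum.swap)
  also have "\<dots> = (\<Sum>i\<in>S. \<Sum>j\<in>?V - S. - (A j i * ?f i j))"
  proof (intro sum.cong refl)
    fix i j
    show "- (A j i * (1 - ?f j i)) = - (A j i * ?f i j)"
      using logistic_minus[of "v i - v j"] by simp
  qed
  also have "(\<Sum>i\<in>S. \<Sum>j\<in>?V. ?g i j) = (\<Sum>i\<in>S. \<Sum>j\<in>?V - S. A i j * (1 - ?f i j))"
    using S by (intro sum.cong[OF refl] sum.mono_neutral_cong_right) (auto simp: algebra_simps)
  also have "(\<Sum>i\<in>S. \<Sum>j\<in>?V - S. - (A j i * ?f i j)) + (\<Sum>i\<in>S. \<Sum>j\<in>?V - S. A i j * (1 - ?f i j))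
      = (\<Sum>i\<in>S. \<Sum>j\<in>?V - S. A i j - (A i j + A j i) * ?f i j)"
    unfolding sum.distrib[symmetric] by (intro sum.cong refl) (simp add: algebra_simps)
  finally show ?thesis using le0 by simp
qed

text \<open>The summand is antisymmetric in \<open>i\<close> and \<open>j\<close>, so the
  contributions from inside \<open>S\<close> cancel.\<close>

lemma sum_noise_eq:
  assumes S: "S \<subseteq> {1..N}"
  shows "(\<Sum>i\<in>S. noise N A u i) =
    (\<Sum>i\<in>S. \<Sum>j\<in>{1..N} - S. A i j - (A i j + A j i) * logistic (u i - u j))"
proof -
  define t where "t i j = A i j - (A i j + A j i) * logistic (u i - u j)" for i j
  have anti: "t i j = - t j i" for i j
  proof -
    have e: "logistic (u j - u i) = 1 - logistic (u i - u j)"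
      using logistic_minus[of "u i - u j"] by simp
    show ?thesis unfolding t_def e by (simp add: algebra_simps)
  qed
  have fin: "finite S" using S finite_subset by auto
  have "(\<Sum>i\<in>S. \<Sum>j\<in>S. t i j) = (\<Sum>j\<in>S. \<Sum>i\<in>S. t i j)" by (rule sum.swap)
  also have "\<dots> = - (\<Sum>j\<in>S. \<Sum>i\<in>S. t j i)"
    unfolding sum_negf[symmetric] by (intro sum.cong refl anti)
  finally have z: "(\<Sum>i\<in>S. \<Sum>j\<in>S. t i j) = 0" by simp
  have "(\<Sum>i\<in>S. noise N A u i) = (\<Sum>i\<in>S. (\<Sum>j\<in>{1..N} - S. t i j) + (\<Sum>j\<in>S. t i j))"
    unfolding noise_def t_def[symmetric] using S by (intro sum.cong refl sum.subset_diff) auto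
  then show ?thesis using z by (simp add: sum.distrib t_def)
qed

text \<open>Subtracting the cut inequality at \<open>v\<close> from the noise identity at
  \<open>u\<close> bounds a sum over the cut of \<open>S\<close>, with terms
  \<open>logistic (v i - v j) - logistic (u i - u j)\<close>, by the noise. All terms are
  nonnegative because \<open>S\<close> is an upper level set, and each edge that also avoids
  \<open>S'\<close> contributes at least the slope constant times \<open>\<tau>\<close>.\<close>

lemma near_max_cut_edges:
  assumes max: "near_max N A u v" and A: "\<And>i j. 0 \<le> A i j"
    and M: "\<And>i j. i \<in> {1..N} \<Longrightarrow> j \<in> {1..N} \<Longrightarrow> u i - u j \<le> M"
    and S: "S \<subseteq> S'" "S' \<subseteq> {1..N}"
    and upper: "\<And>i j. i \<in> S \<Longrightarrow> j \<in> {1..N} - S \<Longrightarrow> v j - u j \<le> v i - u i"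
    and gap: "\<And>i j. i \<in> S \<Longrightarrow> j \<in> {1..N} - S' \<Longrightarrow> v j - u j + \<tau> \<le> v i - u i"
  shows "(logistic (- (M + 1)))\<^sup>2 * \<tau> * (\<Sum>i\<in>S. \<Sum>j\<in>{1..N} - S'. A i j + A j i)
    \<le> (\<Sum>i\<in>S. noise N A u i)"
proof -
  let ?V = "{1..N}"
  define c where "c = (logistic (- (M + 1)))\<^sup>2"
  let ?g = "\<lambda>i j. (A i j + A j i) * (logistic (v i - v j) - logistic (u i - u j))"
  have SV: "S \<subseteq> ?V" using S by auto
  have c: "0 \<le> c" by (simp add: c_def)
  have g: "(A i j + A j i) * (c * ((v i - u i) - (v j - u j))) \<le> ?g i j"
    if ij: "i \<in> S" "j \<in> ?V - S" for i j
  proof -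
    have "u i - u j \<le> M" "u j - u i \<le> M" using M ij SV by auto
    moreover have "(v i - u i) - (v j - u j) \<le> 1" "(v j - u j) - (v i - u i) \<le> 1"
      using max ij SV unfolding near_max_def near_def by blast+
    moreover have "v j - u j \<le> v i - u i" using upper ij by blast
    ultimately have "c * ((v i - v j) - (u i - u j)) \<le> logistic (v i - v j) - logistic (u i - u j)"
      unfolding c_def by (intro logistic_diff_ge) auto
    moreover have "(v i - v j) - (u i - u j) = (v i - u i) - (v j - u j)" by simp
    ultimately show ?thesis using A by (intro mult_left_mono) auto
  qed
  have g0: "0 \<le> ?g i j" if ij: "i \<in> S" "j \<in> ?V - S" for i j
  proof -
    have "0 \<le> (A i j + A j i) * (c * ((v i - u i) - (v j - u j)))"
      using A c upper[OF ij] by (intro mult_nonneg_nonneg) auto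
    then show ?thesis using g[OF ij] by linarith
  qed
  have "c * \<tau> * (\<Sum>i\<in>S. \<Sum>j\<in>?V - S'. A i j + A j i)
      = (\<Sum>i\<in>S. \<Sum>j\<in>?V - S'. (A i j + A j i) * (c * \<tau>))"
    by (simp add: sum_distrib_left mult_ac)
  also have "\<dots> \<le> (\<Sum>i\<in>S. \<Sum>j\<in>?V - S'. ?g i j)"
  proof (intro sum_mono)
    fix i j assume ij: "i \<in> S" "j \<in> ?V - S'"
    have "(A i j + A j i) * (c * \<tau>) \<le> (A i j + A j i) * (c * ((v i - u i) - (v j - u j)))"
      using A c gap[OF ij] by (intro mult_left_mono) auto
    also have "\<dots> \<le> ?g i j" using ij S by (intro g) auto
    finally show "(A i j + A j i) * (c * \<tau>) \<le> ?g i j" .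
  qed
  also have "\<dots> \<le> (\<Sum>i\<in>S. \<Sum>j\<in>?V - S. ?g i j)"
    using S g0 by (intro sum_mono sum_mono2) auto
  also have "\<dots> \<le> (\<Sum>i\<in>S. noise N A u i)"
  proof -
    have "(\<Sum>i\<in>S. noise N A u i) - (\<Sum>i\<in>S. \<Sum>j\<in>?V - S. ?g i j) =
       (\<Sum>i\<in>S. \<Sum>j\<in>?V - S. A i j - (A i j + A j i) * logistic (v i - v j))"
      unfolding sum_noise_eq[OF SV] sum_subtractf[symmetric]
      by (intro sum.cong refl) (simp add: algebra_simps)
    then show ?thesis using near_max_cut[OF max SV upper] by simp
  qed
  finally show ?thesis by (simp add: c_def)
qed

lemma ex_near_max:
  assumes N: "1 \<le> N" and u1: "u 1 = 0"
  shows "\<exists>v. v \<in> extensional {1..N} \<and> v 1 = 0 \<and> near_max N A u v"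
proof -
  let ?V = "{1..N}"
  \<comment> \<open>The singleton at indices outside the range keeps the product compact and forces
    the maximizer to be extensional.\<close>
  define B where "B i = (if i \<in> ?V then {u i - 1 .. u i + 1} else {undefined :: real})" for i
  define K where "K = (PiE UNIV B \<inter> {v. v 1 = 0}) \<inter> {v. near N u v}"
  have compB: "compact (PiE UNIV B)"
  proof -
    have "compactin (product_topology (\<lambda>i. euclidean) UNIV) (PiE UNIV B)"
      unfolding compactin_PiE by (auto simp: B_def)
    then show ?thesis by (simp add: euclidean_product_topology)
  qed
  have coord: "continuous_on X (\<lambda>v. v i)" for X :: "(nat \<Rightarrow> real) set" and i
    by (rule continuous_on_subset[OF continuous_on_product_coordinates subset_UNIV])
  have cl1: "closed {v :: nat \<Rightarrow> real. v 1 = 0}"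
    by (intro closed_Collect_eq continuous_intros coord)
  have eq: "{v. near N u v} = (\<Inter>i\<in>?V. \<Inter>j\<in>?V. {v. (v i - u i) - (v j - u j) \<le> 1})"
    by (auto simp: near_def)
  have cl2: "closed {v. near N u v}"
    unfolding eq by (intro closed_INT ballI closed_Collect_le continuous_intros coord)
  have compK: "compact K"
    unfolding K_def by (intro compact_Int_closed compB cl1 cl2)
  define u' where "u' = restrict u ?V"
  have "u' \<in> PiE UNIV B"
    by (simp add: PiE_UNIV_domain B_def u'_def)
  moreover have "near N u u'"
    by (simp add: near_def u'_def)
  moreover have "u' 1 = 0"
    using N u1 by (simp add: u'_def)
  ultimately have "u' \<in> K"
    by (simp add: K_def)
  then have neK: "K \<noteq> {}" by auto
  have cont: "continuous_on K (log_likelihood N A)"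
    unfolding log_likelihood_def logistic_def
    by (intro continuous_intros coord) (auto simp: add_nonneg_eq_0_iff)
  obtain v where v: "v \<in> K" "\<And>x. x \<in> K \<Longrightarrow> log_likelihood N A x \<le> log_likelihood N A v"
    using continuous_attains_sup[OF compK neK cont] by blast
  have "log_likelihood N A x \<le> log_likelihood N A v" if x: "near N u x" for x
  proof -
    \<comment> \<open>An arbitrary competitor is translated to vanish at 1, which changes neither
      its likelihood nor its feasibility and puts it into \<open>K\<close>.\<close>
    define y where "y = restrict (\<lambda>i. x i - x 1) ?V"
    have y1: "y 1 = 0" using N by (simp add: y_def)
    have ny: "near N u y"
      unfolding near_def
    proof (intro ballI)
      fix i j assume ij: "i \<in> {1..N}" "j \<in> {1..N}"
      then have "(x i - u i) - (x j - u j) \<le> 1" using x unfolding near_def by blast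
      then show "(y i - u i) - (y j - u j) \<le> 1" using ij by (simp add: y_def)
    qed
    have "\<bar>y i - u i\<bar> \<le> 1" if "i \<in> ?V" for i
    proof -
      have "1 \<in> ?V" using N by simp
      then have "(y i - u i) - (y 1 - u 1) \<le> 1" "(y 1 - u 1) - (y i - u i) \<le> 1"
        using ny that unfolding near_def by blast+
      then show ?thesis using y1 u1 by simp
    qed
    then have "y \<in> PiE UNIV B"
      by (force simp: B_def y_def PiE_def abs_le_iff)
    then have "y \<in> K" using y1 ny by (simp add: K_def)
    moreover have "log_likelihood N A x = log_likelihood N A y"
      by (rule log_likelihood_cong[of _ _ _ "x 1"]) (simp add: y_def)
    ultimately show ?thesis using v by simp
  qed
  moreover have "v \<in> extensional ?V"
    unfolding extensional_def
  proof (intro CollectI allI impI)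
    fix i assume "i \<notin> ?V"
    moreover have "v i \<in> B i" using v(1) by (auto simp: K_def)
    ultimately show "v i = undefined" by (simp only: B_def if_False singleton_iff)
  qed
  ultimately show ?thesis using v(1) by (auto simp: K_def near_max_def)
qed

text \<open>With slack \<open>1 - \<rho>\<close> in all constraints every direction is feasible both
  ways, so all directional derivatives vanish. Concavity then makes \<open>v\<close> a global
  maximizer, and \<open>conn\<close> makes the concavity strict modulo constants, which the
  normalization at 1 excludes.\<close>

lemma near_max_interior_is_mle:
  assumes N: "1 \<le> N" and max: "near_max N A u v"
    and v: "v \<in> extensional {1..N}" "v 1 = 0"
    and int: "\<And>i j. i \<in> {1..N} \<Longrightarrow> j \<in> {1..N} \<Longrightarrow> (v i - u i) - (v j - u j) \<le> \<rho>" and \<rho>: "\<rho> < 1"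
    and A: "\<And>i j. 0 \<le> A i j"
    and conn: "\<And>h :: nat \<Rightarrow> real. (\<And>i j. i \<in> {1..N} \<Longrightarrow> j \<in> {1..N} \<Longrightarrow> 0 < A i j \<Longrightarrow> h i = h j) \<Longrightarrow>
      (\<forall>i\<in>{1..N}. h i = h 1)"
  shows "is_mle N A v \<and> (\<forall>w. is_mle N A w \<longrightarrow> w = v)"
proof -
  let ?V = "{1..N}"
  let ?L = "log_likelihood N A"
  have grad0: "dir_deriv N A v h = 0" for h
  proof -
    define H where "H = 1 + (\<Sum>i\<in>?V. \<bar>h i\<bar>)"
    have H0: "0 < H" unfolding H_def by (simp add: add_pos_nonneg sum_nonneg)
    have H: "\<bar>h i\<bar> \<le> H" if "i \<in> ?V" for i
      using that member_le_sum[of i ?V "\<lambda>i. \<bar>h i\<bar>"] by (simp add: H_def)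
    \<comment> \<open>Each coordinate moves by at most half of the slack, so a difference of two
      moves by at most all of it.\<close>
    define e where "e = (1 - \<rho>) / (2 * H)"
    have e: "0 < e" using \<rho> H0 by (simp add: e_def)
    show ?thesis
    proof (rule DERIV_local_max[OF log_likelihood_deriv e], intro allI impI)
      fix s assume s: "\<bar>0 - s\<bar> < e"
      have "near N u (\<lambda>i. v i + s * h i)"
        unfolding near_def
      proof (intro ballI)
        fix i j assume ij: "i \<in> ?V" "j \<in> ?V"
        have b: "\<bar>s * h k\<bar> \<le> (1 - \<rho>) / 2" if "k \<in> ?V" for k
        proof -
          have "\<bar>s * h k\<bar> \<le> e * H"
            unfolding abs_mult using s H[OF that] e by (intro mult_mono) auto
          then show ?thesis using H0 by (simp add: e_def)
        qed
        show "v i + s * h i - u i - (v j + s * h j - u j) \<le> 1"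
          using int[OF ij] b[OF ij(1)] b[OF ij(2)] by (simp add: abs_le_iff field_simps)
      qed
      then show "?L (\<lambda>i. v i + s * h i) \<le> ?L (\<lambda>i. v i + 0 * h i)"
        using max by (simp add: near_max_def)
    qed
  qed
  have main: "?L w < ?L v" if w: "w \<in> extensional ?V" "w 1 = 0" "w \<noteq> v" for w
  proof -
    define h where "h i = w i - v i" for i
    let ?a = "\<lambda>i j. A i j * ln (logistic (w i - w j))"
    let ?b = "\<lambda>i j. A i j * ln (logistic (v i - v j)) + A i j * ((1 - logistic (v i - v j)) * (h i - h j))"
    have ineq: "?a i j \<le> ?b i j" for i j
    proof (cases "w i - w j = v i - v j")
      case True
      then have "h i - h j = 0" by (simp add: h_def)
      then show ?thesis using True by simp
    next
      case False
      have "A i j * ln (logistic (w i - w j)) \<le> A i j * (ln (logistic (v i - v j)) + (1 - logistic (v i - v j)) * ((w i - w j) - (v i - v j)))"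
        using ln_logistic_tangent[OF False] A by (intro mult_left_mono) auto
      then show ?thesis by (simp add: h_def algebra_simps)
    qed
    \<comment> \<open>A pair on which the tangent inequality is strict. Without one,
      \<open>w - v\<close> would be constant, hence zero.\<close>
    have "\<exists>i\<in>?V. \<exists>j\<in>?V. 0 < A i j \<and> h i \<noteq> h j"
    proof (rule ccontr)
      assume "\<not> ?thesis"
      then have "\<forall>i\<in>?V. h i = h 1" by (intro conn) blast
      moreover have "h 1 = 0" using v w by (simp add: h_def)
      ultimately have "w i = v i" if "i \<in> ?V" for i using that by (simp add: h_def)
      then have "w = v" using v w by (meson extensionalityI)
      then show False using w by simp
    qed
    then obtain i0 j0 where ij0: "i0 \<in> ?V" "j0 \<in> ?V" "0 < A i0 j0" "h i0 \<noteq> h j0" by blast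
    then have j0: "j0 \<in> ?V - {i0}" by auto
    have "w i0 - w j0 \<noteq> v i0 - v j0" using ij0 by (simp add: h_def)
    from ln_logistic_tangent[OF this] have "A i0 j0 * ln (logistic (w i0 - w j0))
        < A i0 j0 * (ln (logistic (v i0 - v j0)) + (1 - logistic (v i0 - v j0)) * ((w i0 - w j0) - (v i0 - v j0)))"
      using ij0 by (intro mult_strict_left_mono) auto
    then have strict: "?a i0 j0 < ?b i0 j0" by (simp add: h_def algebra_simps)
    have "?L w < (\<Sum>i\<in>?V. \<Sum>j\<in>?V - {i}. ?b i j)"
      unfolding log_likelihood_def
    proof (rule sum_strict_mono_ex1)
      show "\<forall>i\<in>?V. (\<Sum>j\<in>?V - {i}. ?a i j) \<le> (\<Sum>j\<in>?V - {i}. ?b i j)"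
        by (intro ballI sum_mono ineq)
      have "(\<Sum>j\<in>?V - {i0}. ?a i0 j) < (\<Sum>j\<in>?V - {i0}. ?b i0 j)"
        using ineq strict j0 by (intro sum_strict_mono_ex1) auto
      then show "\<exists>i\<in>?V. (\<Sum>j\<in>?V - {i}. ?a i j) < (\<Sum>j\<in>?V - {i}. ?b i j)" using ij0 by blast
    qed simp
    also have "\<dots> = ?L v + dir_deriv N A v h"
      by (simp add: log_likelihood_def dir_deriv_def sum.distrib)
    finally show ?thesis using grad0 by simp
  qed
  have m: "is_mle N A v"
    unfolding is_mle_def is_arg_max_def using v main by (metis less_asym)
  moreover have "w = v" if "is_mle N A w" for w
    using that main[of w] v unfolding is_mle_def is_arg_max_def by blast
  ultimately show ?thesis by blast
qed

subsection \<open>Expansion\<close>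

text \<open>Edges are stored from left to right, so the two terms distinguish on which side the end
  in \<open>S\<close> lies.\<close>

definition out_edges :: "nat \<Rightarrow> nat \<Rightarrow> (nat \<times> nat) set \<Rightarrow> nat set \<Rightarrow> nat set \<Rightarrow> nat" where
  "out_edges n m E S S' = edge_count E (S \<inter> {1..n}) ({n+1..n+m} - S') +
     edge_count E ({1..n} - S') (S \<inter> {n+1..n+m})"

definition left_vol :: "nat \<Rightarrow> nat \<Rightarrow> nat set \<Rightarrow> real" where
  "left_vol n d S = real d * real (card (S \<inter> {1..n}))"

definition right_vol :: "nat \<Rightarrow> nat \<Rightarrow> nat \<Rightarrow> nat set \<Rightarrow> real" where
  "right_vol n m d S = right_deg n m d * real (card (S \<inter> {n+1..n+m}))"

context
  fixes n m d :: nat and E :: "(nat \<times> nat) set"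
  assumes G: "good_graph n m d E" and nm: "1 \<le> n" "n \<le> m" and d: "1 \<le> d"
    and N: "3 \<le> n + m"
    and D: "65536 * ln (real (n + m)) ^ 2 \<le> right_deg n m d"
begin

private abbreviation (input) "D \<equiv> right_deg n m d"
private abbreviation (input) "logN \<equiv> ln (real (n + m))"
private abbreviation (input) "vol S \<equiv> max (left_vol n d S) (right_vol n m d S)"

lemma logN_ge_1: "1 \<le> logN"
proof -
  have "exp 1 \<le> real (n + m)" using exp_le N by linarith
  then show ?thesis using N by (subst ln_ge_iff) auto
qed

text \<open>The expansion argument gains a factor \<open>D / (128 logN)\<close> in volume. The first
  fact, which uses that \<open>D\<close> is of order \<open>logN ^ 2\<close>, replaces this factor
  by \<open>sqrt D\<close>.\<close>

lemma D_facts: "128 * logN \<le> sqrt D" "65536 * logN \<le> D" "1 \<le> D" "D \<le> real d" "D * real m = real n * real d"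
proof -
  have "128 * logN = sqrt (16384 * logN ^ 2)" using logN_ge_1 by (simp add: real_sqrt_mult)
  also have "\<dots> \<le> sqrt D" using D by (intro real_sqrt_le_mono) (smt (verit) zero_le_power2)
  finally show "128 * logN \<le> sqrt D" .
  have "logN * 1 \<le> logN * logN" using logN_ge_1 by (intro mult_left_mono) auto
  then show 1: "65536 * logN \<le> D" using D by (simp add: power2_eq_square)
  then show "1 \<le> D" using logN_ge_1 by linarith
  have "real n / real m \<le> 1" using nm by simp
  then show "D \<le> real d" 
    unfolding right_deg_def using mult_right_mono[of "real n / real m" 1 "real d"] by simp
  show "D * real m = real n * real d" using nm by (simp add: right_deg_def)
qed

lemma edges_sub: "E \<subseteq> {1..n} \<times> {n+1..n+m}"
  using G by (simp add: good_graph_def)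

lemma finite_edges: "finite E"
  using edges_sub finite_subset by blast

lemma edge_bound:
  assumes "A \<subseteq> {1..n}" "B \<subseteq> {n+1..n+m}"
  shows "edge_count E A B \<le> 7/4 * real (card A) * real (card B) * real d / real m
          + 4 * (real (card A) + real (card B)) * logN"
  using G assms unfolding good_graph_def by blast

lemma edge_count_split_right: "edge_count E A B = edge_count E A (B \<inter> X) + edge_count E A (B - X)"
proof -
  have "E \<inter> A \<times> B = (E \<inter> A \<times> (B \<inter> X)) \<union> (E \<inter> A \<times> (B - X))" by auto
  then show ?thesis unfolding edge_count_def
    using finite_edges by (simp add: card_Un_disjoint[symmetric] disjoint_iff)
qed

lemma edge_count_split_left: "edge_count E A B = edge_count E (A \<inter> X) B + edge_count E (A - X) B"
proof -
  have "E \<inter> A \<times> B = (E \<inter> (A \<inter> X) \<times> B) \<union> (E \<inter> (A - X) \<times> B)" by auto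
  then show ?thesis unfolding edge_count_def
    using finite_edges by (simp add: card_Un_disjoint[symmetric] disjoint_iff)
qed

lemma edges_from_left:
  assumes "A \<subseteq> {1..n}"
  shows "edge_count E A {n+1..n+m} = d * card A"
proof -
  have fin: "finite A" using assms finite_subset by auto
  have eq: "E \<inter> A \<times> {n+1..n+m} = (\<Union>i\<in>A. E \<inter> {i} \<times> {n+1..n+m})" by auto
  have "edge_count E A {n+1..n+m} = (\<Sum>i\<in>A. edge_count E {i} {n+1..n+m})"
    unfolding edge_count_def eq using fin finite_edges by (intro card_UN_disjoint) auto
  also have "\<dots> = (\<Sum>i\<in>A. d)"
    using G assms unfolding good_graph_def by (intro sum.cong refl) blast
  finally show ?thesis by simp
qed

lemma edges_from_right:
  assumes "B \<subseteq> {n+1..n+m}"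
  shows "63/64 * D * real (card B) \<le> edge_count E {1..n} B"
proof -
  have fin: "finite B" using assms finite_subset by auto
  have eq: "E \<inter> {1..n} \<times> B = (\<Union>j\<in>B. E \<inter> {1..n} \<times> {j})" by auto
  have "edge_count E {1..n} B = (\<Sum>j\<in>B. edge_count E {1..n} {j})"
    unfolding edge_count_def eq using fin finite_edges by (intro card_UN_disjoint) auto
  then have "real (edge_count E {1..n} B) = (\<Sum>j\<in>B. real (edge_count E {1..n} {j}))" by simp
  moreover have "(\<Sum>j\<in>B. 63/64 * D) \<le> (\<Sum>j\<in>B. real (edge_count E {1..n} {j}))"
    using G assms unfolding good_graph_def by (intro sum_mono) blast
  ultimately show ?thesis by (simp add: mult_ac)
qed

text \<open>This is where \<open>7/4 < 2\<close> is used: if \<open>B\<close> is at most half of the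
  right side, the main term of the edge bound accounts for at most \<open>7/8\<close> of the edges
  at a left set of size \<open>a\<close>. The next lemma is the mirror image.\<close>

lemma left_half_mass:
  assumes "2 * real (card B) \<le> real m"
  shows "7/4 * real a * real (card B) * real d / real m \<le> 7/8 * (real d * real a)"
proof -
  have "real a * real d * (2 * real (card B)) \<le> real a * real d * real m"
    using assms by (intro mult_left_mono) auto
  then show ?thesis using nm by (simp add: field_simps)
qed

lemma right_half_mass:
  assumes "2 * real (card A) \<le> real n"
  shows "7/4 * real (card A) * real b * real d / real m \<le> 7/8 * (D * real b)"
proof -
  have "real b * real d * (2 * real (card A)) \<le> real b * real d * real n"
    using assms by (intro mult_left_mono) auto
  then show ?thesis using nm by (simp add: right_deg_def field_simps)
qed

text \<open>The larger of the two volumes of \<open>S\<close> decides which side to follow. At most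
  \<open>1/32\<close> of it leaves \<open>S'\<close>, and if \<open>S'\<close> is at most half on
  both sides, the main term of the edge bound takes at most \<open>7/8\<close>. The rest must come
  from the logarithmic term, which forces \<open>S'\<close> to be large on the opposite
  side.\<close>

lemma growth:
  assumes out: "64 * real (out_edges n m E S S') \<le> left_vol n d S + right_vol n m d S"
  shows "real m < 2 * real (card (S' \<inter> {n+1..n+m})) \<or> real n < 2 * real (card (S' \<inter> {1..n})) \<or>
    sqrt D * vol S \<le> vol S'"
proof (rule ccontr)
  assume neg: "\<not> ?thesis"
  define A where "A = S \<inter> {1..n}"
  define B where "B = S \<inter> {n+1..n+m}"
  define A' where "A' = {1..n} \<inter> S'"
  define B' where "B' = {n+1..n+m} \<inter> S'"
  have small: "2 * real (card B') \<le> real m" "2 * real (card A') \<le> real n"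
    using neg by (auto simp: A'_def B'_def Int_commute)
  have sub: "A \<subseteq> {1..n}" "A' \<subseteq> {1..n}" "B \<subseteq> {n+1..n+m}" "B' \<subseteq> {n+1..n+m}"
    by (auto simp: A_def A'_def B_def B'_def)
  have out1: "64 * real (edge_count E A ({n+1..n+m} - S')) \<le> real d * real (card A) + D * real (card B)"
    and out2: "64 * real (edge_count E ({1..n} - S') B) \<le> real d * real (card A) + D * real (card B)"
    using out by (auto simp: out_edges_def left_vol_def right_vol_def A_def B_def)
  have sq: "sqrt D * sqrt D = D" "0 \<le> sqrt D" using D_facts by auto
  show False
  proof (cases "D * real (card B) \<le> real d * real (card A)")
    case True
    have "real d * real (card A) = real (edge_count E A B') + real (edge_count E A ({n+1..n+m} - S'))"
      using edges_from_left[OF sub(1)] edge_count_split_right[of A "{n+1..n+m}" S']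
      by (simp add: B'_def flip: of_nat_mult of_nat_add)
    moreover have "real (edge_count E A B') \<le> 7/8 * (real d * real (card A)) + 4 * (real (card A) + real (card B')) * logN"
      using edge_bound[OF sub(1,4)] left_half_mass[OF small(1), of "card A"] by linarith
    moreover have "128 * (real (card A) * logN) \<le> real d * real (card A)"
    proof -
      have "128 * logN \<le> real d" using D_facts logN_ge_1 by linarith
      from mult_right_mono[OF this, of "real (card A)"] show ?thesis by (simp add: mult_ac)
    qed
    \<comment> \<open>The share left for the term \<open>4 * card B' * logN\<close> is
      \<open>1 - 1/32 - 7/8 - 1/32 = 1/16\<close>.\<close>
    ultimately have "real d * real (card A) \<le> 128 * logN * real (card B')"
      using out1 True by (simp add: algebra_simps)
    also have "\<dots> \<le> sqrt D * real (card B')" using D_facts by (intro mult_right_mono) auto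
    finally have "sqrt D * (real d * real (card A)) \<le> sqrt D * (sqrt D * real (card B'))"
      using sq by (intro mult_left_mono)
    also have "\<dots> = D * real (card B')" using sq by (simp add: mult.assoc[symmetric])
    finally have "sqrt D * vol S \<le> right_vol n m d S'"
      using True by (simp add: left_vol_def right_vol_def A_def B_def B'_def Int_commute max_absorb1)
    then show False using neg by auto
  next
    case False
    have "63/64 * D * real (card B) \<le> real (edge_count E A' B) + real (edge_count E ({1..n} - S') B)"
      using edges_from_right[OF sub(3)] edge_count_split_left[of "{1..n}" B S'] by (simp add: A'_def)
    moreover have "real (edge_count E A' B) \<le> 7/8 * (D * real (card B)) + 4 * (real (card A') + real (card B)) * logN"
      using edge_bound[OF sub(2,3)] right_half_mass[OF small(2), of "card B"] by linarith
    moreover have "128 * (real (card B) * logN) \<le> D * real (card B)"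
    proof -
      have "128 * logN \<le> D" using D_facts logN_ge_1 by linarith
      from mult_right_mono[OF this, of "real (card B)"] show ?thesis by (simp add: mult_ac)
    qed
    \<comment> \<open>Right degrees may fall short by \<open>1/64\<close>, so the remaining share is
      \<open>63/64 - 1/32 - 7/8 - 1/32 = 3/64\<close>.\<close>
    ultimately have "3 * (D * real (card B)) \<le> 256 * (logN * real (card A'))"
      using out2 False by (simp add: algebra_simps)
    moreover have "0 \<le> logN * real (card A')" using logN_ge_1 by simp
    ultimately have "D * real (card B) \<le> 128 * logN * real (card A')" by linarith
    also have "\<dots> \<le> sqrt D * real (card A')" using D_facts by (intro mult_right_mono) auto
    finally have "sqrt D * (D * real (card B)) \<le> sqrt D * (sqrt D * real (card A'))"
      using sq by (intro mult_left_mono)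
    also have "\<dots> = D * real (card A')" using sq by (simp add: mult.assoc[symmetric])
    also have "\<dots> \<le> real d * real (card A')" using D_facts by (intro mult_right_mono) auto
    finally have "sqrt D * vol S \<le> left_vol n d S'"
      using False by (simp add: left_vol_def right_vol_def A_def B_def A'_def Int_commute max_absorb2)
    then show False using neg by auto
  qed
qed

text \<open>A starting set may be a single right vertex, of volume only \<open>D\<close>. If
  \<open>S'\<close> had no left vertex, all edges at \<open>S\<close> would leave it; so one step
  already gives volume \<open>d\<close>. This is why the number of steps depends on
  \<open>ln n\<close> and not on \<open>ln m\<close>.\<close>

lemma reach_left:
  assumes out: "64 * real (out_edges n m E S S') \<le> left_vol n d S + right_vol n m d S"
    and S: "S \<noteq> {}" "S \<subseteq> S'" "S' \<subseteq> {1..n+m}"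
  shows "real d \<le> vol S'"
proof -
  have "S' \<inter> {1..n} \<noteq> {}"
  proof
    assume e: "S' \<inter> {1..n} = {}"
    define B where "B = S \<inter> {n+1..n+m}"
    have SL: "S \<inter> {1..n} = {}" "{1..n} - S' = {1..n}" using e S by auto
    have "S \<subseteq> {n+1..n+m}" using SL S by force
    then have B: "B \<noteq> {}" "B \<subseteq> {n+1..n+m}" using S by (auto simp: B_def)
    have "finite B" using B finite_subset by auto
    then have "0 < real (card B)" using B by (simp add: card_gt_0_iff)
    then have pos: "0 < D * real (card B)" using D_facts by (intro mult_pos_pos) auto
    have "64 * real (edge_count E {1..n} B) \<le> D * real (card B)"
      using out SL by (simp add: out_edges_def left_vol_def right_vol_def B_def edge_count_def)
    then show False using edges_from_right[OF B(2)] pos by linarith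
  qed
  then have "1 \<le> real (card (S' \<inter> {1..n}))"
    by (metis card_gt_0_iff finite_Int finite_atLeastAtMost of_nat_1 of_nat_le_iff Suc_leI One_nat_def)
  then have "real d * 1 \<le> left_vol n d S'"
    unfolding left_vol_def by (intro mult_left_mono) auto
  then show ?thesis by simp
qed

lemma vol_le: "vol S \<le> real n * real d"
proof -
  have "card (S \<inter> {1..n}) \<le> card {1..n}" "card (S \<inter> {n+1..n+m}) \<le> card {n+1..n+m}"
    by (intro card_mono; simp)+
  then have "left_vol n d S \<le> real d * real n" "right_vol n m d S \<le> D * real m"
    unfolding left_vol_def right_vol_def using D_facts by (intro mult_left_mono; simp)+
  then show ?thesis using D_facts(5) by (simp add: mult.commute)
qed

text \<open>A majority on the left passes to the right in one step: otherwise the edge bound, with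
  logarithmic term at most \<open>8 m logN\<close>, would give
  \<open>D \<le> 256 logN\<close>.\<close>

lemma reach_right_half:
  assumes out: "64 * real (out_edges n m E S S') \<le> left_vol n d S + right_vol n m d S"
    and half: "real n < 2 * real (card (S \<inter> {1..n}))"
  shows "real m < 2 * real (card (S' \<inter> {n+1..n+m}))"
proof (rule ccontr)
  assume neg: "\<not> ?thesis"
  define A where "A = S \<inter> {1..n}"
  define B' where "B' = {n+1..n+m} \<inter> S'"
  have small: "2 * real (card B') \<le> real m" using neg by (simp add: B'_def Int_commute)
  have sub: "A \<subseteq> {1..n}" "B' \<subseteq> {n+1..n+m}" by (auto simp: A_def B'_def)
  have vol: "real n * real d \<le> 2 * (real d * real (card A))"
    using half mult_right_mono[of "real n" "2 * real (card A)" "real d"] by (simp add: A_def mult_ac)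
  have "64 * real (edge_count E A ({n+1..n+m} - S')) \<le> 2 * (real n * real d)"
  proof -
    have "64 * real (edge_count E A ({n+1..n+m} - S')) + 64 * real (edge_count E ({1..n} - S') (S \<inter> {n+1..n+m}))
        \<le> left_vol n d S + right_vol n m d S"
      using out by (simp add: out_edges_def A_def)
    moreover have "left_vol n d S \<le> real n * real d" "right_vol n m d S \<le> real n * real d"
      using vol_le[of S] by auto
    moreover have "0 \<le> real (edge_count E ({1..n} - S') (S \<inter> {n+1..n+m}))" by simp
    ultimately show ?thesis by linarith
  qed
  moreover have "real d * real (card A) = real (edge_count E A B') + real (edge_count E A ({n+1..n+m} - S'))"
    using edges_from_left[OF sub(1)] edge_count_split_right[of A "{n+1..n+m}" S']
    by (simp add: B'_def flip: of_nat_mult of_nat_add)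
  moreover have "real (edge_count E A B') \<le> 7/8 * (real d * real (card A)) + 4 * (real (card A) + real (card B')) * logN"
    using edge_bound[OF sub] left_half_mass[OF small, of "card A"] by linarith
  moreover have "4 * (real (card A) + real (card B')) * logN \<le> 8 * real m * logN"
  proof -
    have "card A \<le> n" "card B' \<le> m"
      using card_mono[OF _ sub(1)] card_mono[OF _ sub(2)] by auto
    then show ?thesis using logN_ge_1 nm by (intro mult_right_mono) auto
  qed
  ultimately have "real d * real (card A) \<le> 128 * (real m * logN)" using vol by (simp add: algebra_simps)
  then have "D * real m \<le> 256 * logN * real m" using vol D_facts(5) by (simp add: mult_ac)
  then have "D \<le> 256 * logN" using nm by (simp add: mult_le_cancel_right)
  then show False using D_facts logN_ge_1 by linarith
qed

text \<open>One step reaches volume \<open>d\<close>, and each of the next \<open>T\<close> steps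
  gains a factor \<open>sqrt D\<close> unless a majority is reached. As no volume exceeds
  \<open>n d\<close>, step \<open>T + 1\<close> has a majority on some side, and one more step
  brings it to the right.\<close>

lemma chain_reaches_right_half:
  fixes S :: "nat \<Rightarrow> nat set"
  assumes S0: "S 0 \<noteq> {}" and mono: "\<And>k. S k \<subseteq> S (Suc k)" and sub: "\<And>k. S k \<subseteq> {1..n+m}"
    and out: "\<And>k. 64 * real (out_edges n m E (S k) (S (Suc k))) \<le> left_vol n d (S k) + right_vol n m d (S k)"
    and T: "real n < sqrt D ^ T"
  shows "real m < 2 * real (card (S (T + 2) \<inter> {n+1..n+m}))"
proof -
  let ?half = "\<lambda>X. real m < 2 * real (card (X \<inter> {n+1..n+m})) \<or> real n < 2 * real (card (X \<inter> {1..n}))"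
  have half_mono: "?half (S (Suc k))" if "?half (S k)" for k
  proof -
    have "card (S k \<inter> {n+1..n+m}) \<le> card (S (Suc k) \<inter> {n+1..n+m})"
      "card (S k \<inter> {1..n}) \<le> card (S (Suc k) \<inter> {1..n})"
      using mono[of k] by (intro card_mono; auto)+
    then show ?thesis using that by linarith
  qed
  have "?half (S (Suc k)) \<or> sqrt D ^ k * real d \<le> vol (S (Suc k))" for k
  proof (induction k)
    case 0
    then show ?case using reach_left[OF out S0 mono sub] by simp
  next
    case (Suc k)
    show ?case
    proof (cases "?half (S (Suc k))")
      case True
      then show ?thesis using half_mono by blast
    next
      case False
      then have "sqrt D * (sqrt D ^ k * real d) \<le> sqrt D * vol (S (Suc k))"
        using Suc D_facts by (intro mult_left_mono) auto
      then show ?thesis using growth[OF out, of "Suc k"] by (auto simp: mult.assoc)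
    qed
  qed
  moreover have "\<not> sqrt D ^ T * real d \<le> vol (S (Suc T))"
  proof -
    have "real n * real d < sqrt D ^ T * real d"
      using d by (intro mult_strict_right_mono T) auto
    then show ?thesis using vol_le[of "S (Suc T)"] by linarith
  qed
  ultimately consider "real m < 2 * real (card (S (Suc T) \<inter> {n+1..n+m}))"
    | "real n < 2 * real (card (S (Suc T) \<inter> {1..n}))" by blast
  then show ?thesis
  proof cases
    case 1
    moreover have "card (S (Suc T) \<inter> {n+1..n+m}) \<le> card (S (Suc (Suc T)) \<inter> {n+1..n+m})"
      using mono[of "Suc T"] by (intro card_mono) auto
    ultimately show ?thesis by simp
  next
    case 2
    from reach_right_half[OF out this] show ?thesis by simp
  qed
qed

lemma right_halves_meet:
  assumes "real m < 2 * real (card (X \<inter> {n+1..n+m}))" "real m < 2 * real (card (Y \<inter> {n+1..n+m}))"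
  shows "X \<inter> Y \<inter> {1..n+m} \<noteq> {}"
proof
  assume e: "X \<inter> Y \<inter> {1..n+m} = {}"
  have "card (X \<inter> {n+1..n+m}) + card (Y \<inter> {n+1..n+m}) =
      card ((X \<inter> {n+1..n+m}) \<union> (Y \<inter> {n+1..n+m}))"
    using e by (intro card_Un_disjoint[symmetric]) (auto simp: disjoint_iff)
  also have "\<dots> \<le> card {n+1..n+m}" by (intro card_mono) auto
  finally show False using assms by simp
qed

end

subsection \<open>The estimation error\<close>

lemma sum_of_bool_edges:
  assumes "finite X" "finite Y"
  shows "(\<Sum>i\<in>X. \<Sum>j\<in>Y. of_bool ((i, j) \<in> E)) = real (card (E \<inter> X \<times> Y))"
proof -
  have "(\<Sum>i\<in>X. \<Sum>j\<in>Y. of_bool ((i, j) \<in> E)) = (\<Sum>p\<in>X \<times> Y. of_bool (p \<in> E) :: real)"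
    by (simp add: sum.cartesian_product case_prod_beta)
  also have "\<dots> = real (card ((X \<times> Y) \<inter> {p. p \<in> E}))"
    using assms by (simp only: sum_of_bool_eq finite_cartesian_product)
  also have "(X \<times> Y) \<inter> {p. p \<in> E} = E \<inter> X \<times> Y" by auto
  finally show ?thesis .
qed

text \<open>The hypothesis on \<open>A\<close> says that every edge has exactly one winner. It is
  unchanged by transposing \<open>A\<close>, so it survives the exchange of winners and
  losers.\<close>

lemma sum_adjacency_eq_out_edges:
  assumes E: "E \<subseteq> {1..n} \<times> {n+1..n+m}" and S: "S \<subseteq> {1..n+m}"
    and A: "\<And>i j. A i j + A j i = of_bool ((i, j) \<in> E) + of_bool ((j, i) \<in> E)"
  shows "(\<Sum>i\<in>S. \<Sum>j\<in>{1..n+m} - S'. A i j + A j i) = real (out_edges n m E S S')"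
proof -
  let ?V = "{1..n+m}"
  have fin: "finite S" using S finite_subset by auto
  have "(\<Sum>i\<in>S. \<Sum>j\<in>?V - S'. A i j + A j i) =
      (\<Sum>i\<in>S. \<Sum>j\<in>?V - S'. of_bool ((i, j) \<in> E)) + (\<Sum>i\<in>S. \<Sum>j\<in>?V - S'. of_bool ((j, i) \<in> E))"
    unfolding A by (simp only: sum.distrib)
  also have "(\<Sum>i\<in>S. \<Sum>j\<in>?V - S'. of_bool ((j, i) \<in> E) :: real) = (\<Sum>j\<in>?V - S'. \<Sum>i\<in>S. of_bool ((j, i) \<in> E))"
    by (rule sum.swap)
  also have "(\<Sum>i\<in>S. \<Sum>j\<in>?V - S'. of_bool ((i, j) \<in> E)) = real (card (E \<inter> S \<times> (?V - S')))"
    using fin by (intro sum_of_bool_edges) auto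
  also have "(\<Sum>j\<in>?V - S'. \<Sum>i\<in>S. of_bool ((j, i) \<in> E)) = real (card (E \<inter> (?V - S') \<times> S))"
    using fin by (intro sum_of_bool_edges) auto
  also have "E \<inter> S \<times> (?V - S') = E \<inter> (S \<inter> {1..n}) \<times> ({n+1..n+m} - S')" using E by auto
  also have "E \<inter> (?V - S') \<times> S = E \<inter> ({1..n} - S') \<times> (S \<inter> {n+1..n+m})" using E by auto
  finally show ?thesis by (simp add: out_edges_def edge_count_def)
qed

lemma sum_vweight:
  assumes S: "S \<subseteq> {1..n+m}"
  shows "(\<Sum>i\<in>S. vweight n m d i) = left_vol n d S + right_vol n m d S"
proof -
  have "S = (S \<inter> {1..n}) \<union> (S \<inter> {n+1..n+m})" using S by auto
  then have "(\<Sum>i\<in>S. vweight n m d i) = (\<Sum>i\<in>(S \<inter> {1..n}) \<union> (S \<inter> {n+1..n+m}). vweight n m d i)"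
    by simp
  also have "\<dots> = (\<Sum>i\<in>S \<inter> {1..n}. vweight n m d i) + (\<Sum>i\<in>S \<inter> {n+1..n+m}. vweight n m d i)"
    by (intro sum.union_disjoint) auto
  also have "(\<Sum>i\<in>S \<inter> {1..n}. vweight n m d i) = (\<Sum>i\<in>S \<inter> {1..n}. real d)"
    by (intro sum.cong) (auto simp: vweight_def)
  also have "(\<Sum>i\<in>S \<inter> {n+1..n+m}. vweight n m d i) = (\<Sum>i\<in>S \<inter> {n+1..n+m}. right_deg n m d)"
    by (intro sum.cong) (auto simp: vweight_def)
  finally show ?thesis by (simp add: left_vol_def right_vol_def)
qed

context
  fixes n m d :: nat and E :: "(nat \<times> nat) set"
  assumes G: "good_graph n m d E" and nm: "1 \<le> n" "n \<le> m" and d: "1 \<le> d"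
    and N: "3 \<le> n + m"
    and D: "65536 * ln (real (n + m)) ^ 2 \<le> right_deg n m d"
begin

text \<open>The level sets of \<open>v - u\<close> at depth \<open>k * \<tau>\<close> below the
  maximum form a chain as required by the expansion argument. The constant in \<open>\<tau>\<close>
  is \<open>384 = 6 * 64\<close>: the noise level times the factor demanded of
  \<open>out_edges\<close>.\<close>

lemma upper_level_set_large:
  assumes max: "near_max (n + m) A u v" and A0: "\<And>i j. 0 \<le> A i j"
    and A: "\<And>i j. A i j + A j i = of_bool ((i, j) \<in> E) + of_bool ((j, i) \<in> E)"
    and M: "\<And>i j. i \<in> {1..n+m} \<Longrightarrow> j \<in> {1..n+m} \<Longrightarrow> u i - u j \<le> M"
    and noise: "\<And>i. i \<in> {1..n+m} \<Longrightarrow> \<bar>noise (n + m) A u i\<bar> \<le> 6 * \<epsilon> * vweight n m d i"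
    and \<epsilon>: "0 < \<epsilon>" and \<tau>: "\<tau> = 384 * \<epsilon> / (logistic (- (M + 1)))\<^sup>2"
    and T: "real n < sqrt (right_deg n m d) ^ T"
  shows "real m < 2 * real (card
    ({i\<in>{1..n+m}. \<forall>j\<in>{1..n+m}. v j - u j - real (T + 2) * \<tau> \<le> v i - u i} \<inter> {n+1..n+m}))"
proof -
  let ?V = "{1..n+m}"
  let ?\<delta> = "\<lambda>i. v i - u i"
  define S where "S k = {i\<in>?V. \<forall>j\<in>?V. ?\<delta> j - real k * \<tau> \<le> ?\<delta> i}" for k
  define c where "c = (logistic (- (M + 1)))\<^sup>2"
  have c: "0 < c" using logistic_pos[of "- (M + 1)"] by (simp add: c_def)
  have ctau: "c * \<tau> = 384 * \<epsilon>" using c by (simp add: \<tau> c_def)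
  have tau0: "0 < \<tau>" using \<epsilon> c by (simp add: \<tau> c_def)
  have Sub: "S k \<subseteq> ?V" for k by (auto simp: S_def)
  have E: "E \<subseteq> {1..n} \<times> {n+1..n+m}" using G by (simp add: good_graph_def)
  have mono: "S k \<subseteq> S (Suc k)" for k
  proof
    fix i assume i: "i \<in> S k"
    have "real k * \<tau> \<le> real (Suc k) * \<tau>" using tau0 by (intro mult_right_mono) auto
    then show "i \<in> S (Suc k)" using i unfolding S_def by force
  qed
  have S0: "S 0 \<noteq> {}"
  proof -
    have "Max (?\<delta> ` ?V) \<in> ?\<delta> ` ?V" using nm by (intro Max_in) auto
    then obtain i where i: "i \<in> ?V" "?\<delta> i = Max (?\<delta> ` ?V)" by auto
    have "?\<delta> j \<le> ?\<delta> i" if "j \<in> ?V" for j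
      unfolding i(2) using that by (intro Max_ge) auto
    then have "i \<in> S 0" using i(1) by (simp add: S_def)
    then show ?thesis by blast
  qed
  have out: "64 * real (out_edges n m E (S k) (S (Suc k))) \<le> left_vol n d (S k) + right_vol n m d (S k)" for k
  proof -
    have "c * \<tau> * (\<Sum>i\<in>S k. \<Sum>j\<in>?V - S (Suc k). A i j + A j i) \<le> (\<Sum>i\<in>S k. noise (n + m) A u i)"
      unfolding c_def
    proof (rule near_max_cut_edges[OF max A0 M mono Sub])
      fix i j assume ij: "i \<in> S k" "j \<in> ?V - S k"
      then obtain l where "l \<in> ?V" "?\<delta> j < ?\<delta> l - real k * \<tau>" by (auto simp: S_def not_le)
      then show "?\<delta> j \<le> ?\<delta> i" using ij(1) unfolding S_def by force
    next
      fix i j assume ij: "i \<in> S k" "j \<in> ?V - S (Suc k)"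
      then obtain l where "l \<in> ?V" "?\<delta> j < ?\<delta> l - real (Suc k) * \<tau>" by (auto simp: S_def not_le)
      moreover have "?\<delta> l - real k * \<tau> \<le> ?\<delta> i" using ij(1) \<open>l \<in> ?V\<close> unfolding S_def by blast
      ultimately show "?\<delta> j + \<tau> \<le> ?\<delta> i" by (simp add: algebra_simps)
    qed
    also have "\<dots> \<le> (\<Sum>i\<in>S k. 6 * \<epsilon> * vweight n m d i)"
    proof (rule sum_mono)
      fix i assume "i \<in> S k"
      then show "noise (n + m) A u i \<le> 6 * \<epsilon> * vweight n m d i"
        using Sub[of k] noise[of i] by auto
    qed
    also have "\<dots> = 6 * \<epsilon> * (left_vol n d (S k) + right_vol n m d (S k))"
      by (simp add: sum_distrib_left[symmetric] sum_vweight[OF Sub])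
    finally have "6 * \<epsilon> * (64 * real (out_edges n m E (S k) (S (Suc k))))
        \<le> 6 * \<epsilon> * (left_vol n d (S k) + right_vol n m d (S k))"
      unfolding sum_adjacency_eq_out_edges[OF E Sub A] ctau by simp
    then show ?thesis using \<epsilon> by (simp only: mult_le_cancel_left_pos)
  qed
  show ?thesis
    using chain_reaches_right_half[OF G nm d N D S0 mono Sub out T] unfolding S_def .
qed

text \<open>The upper level set and, by the symmetry, the lower one each hold a majority of the
  right side, hence share a vertex \<open>p\<close>, through which \<open>i\<close> and
  \<open>j\<close> are compared.\<close>

lemma near_max_range:
  assumes max: "near_max (n + m) A u v" and A0: "\<And>i j. 0 \<le> A i j"
    and A: "\<And>i j. A i j + A j i = of_bool ((i, j) \<in> E) + of_bool ((j, i) \<in> E)"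
    and M: "\<And>i j. i \<in> {1..n+m} \<Longrightarrow> j \<in> {1..n+m} \<Longrightarrow> u i - u j \<le> M"
    and noise: "\<And>i. i \<in> {1..n+m} \<Longrightarrow> \<bar>noise (n + m) A u i\<bar> \<le> 6 * \<epsilon> * vweight n m d i"
    and \<epsilon>: "0 < \<epsilon>" and \<tau>: "\<tau> = 384 * \<epsilon> / (logistic (- (M + 1)))\<^sup>2"
    and T: "real n < sqrt (right_deg n m d) ^ T"
    and ij: "i \<in> {1..n+m}" "j \<in> {1..n+m}"
  shows "(v i - u i) - (v j - u j) \<le> 2 * real (T + 2) * \<tau>"
proof -
  let ?V = "{1..n+m}"
  let ?X = "{i\<in>?V. \<forall>j\<in>?V. v j - u j - real (T + 2) * \<tau> \<le> v i - u i}"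
  let ?Y = "{i\<in>?V. \<forall>j\<in>?V. - v j - - u j - real (T + 2) * \<tau> \<le> - v i - - u i}"
  have X: "real m < 2 * real (card (?X \<inter> {n+1..n+m}))"
    by (rule upper_level_set_large[OF max A0 A M noise \<epsilon> \<tau> T])
  have Y: "real m < 2 * real (card (?Y \<inter> {n+1..n+m}))"
  proof (rule upper_level_set_large[OF near_max_uminus[OF max] A0 _ _ _ \<epsilon> \<tau> T])
    show "A j i + A i j = of_bool ((i, j) \<in> E) + of_bool ((j, i) \<in> E)" for i j
      using A[of i j] by simp
    show "- u i - - u j \<le> M" if "i \<in> ?V" "j \<in> ?V" for i j
      using M[of j i] that by simp
    show "\<bar>noise (n + m) (\<lambda>i j. A j i) (\<lambda>i. - u i) i\<bar> \<le> 6 * \<epsilon> * vweight n m d i" if "i \<in> ?V" for i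
      unfolding noise_uminus using noise[OF that] by simp
  qed
  obtain p where p: "p \<in> ?X" "p \<in> ?Y"
    using right_halves_meet[OF G nm d N D X Y] by blast
  have "v i - u i - real (T + 2) * \<tau> \<le> v p - u p" using p(1) ij(1) by blast
  moreover have "- v j - - u j - real (T + 2) * \<tau> \<le> - v p - - u p" using p(2) ij(2) by blast
  ultimately show ?thesis by (simp add: algebra_simps)
qed

text \<open>A nonempty set that no edge leaves is a constant chain, so it holds a majority of the
  right side. The set where \<open>h\<close> equals \<open>h 1\<close> and its complement cannot
  both do so.\<close>

lemma good_graph_connected:
  fixes h :: "nat \<Rightarrow> real" and A :: "nat \<Rightarrow> nat \<Rightarrow> real"
  assumes A0: "\<And>i j. 0 \<le> A i j"
    and A: "\<And>i j. A i j + A j i = of_bool ((i, j) \<in> E) + of_bool ((j, i) \<in> E)"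
    and h: "\<And>i j. i \<in> {1..n+m} \<Longrightarrow> j \<in> {1..n+m} \<Longrightarrow> 0 < A i j \<Longrightarrow> h i = h j"
    and T: "real n < sqrt (right_deg n m d) ^ T"
  shows "\<forall>i\<in>{1..n+m}. h i = h 1"
proof (rule ccontr)
  let ?V = "{1..n+m}"
  assume neg: "\<not> ?thesis"
  define X where "X = {i\<in>?V. h i = h 1}"
  define Y where "Y = {i\<in>?V. h i \<noteq> h 1}"
  have E: "E \<subseteq> {1..n} \<times> {n+1..n+m}" using G by (simp add: good_graph_def)
  have large: "real m < 2 * real (card (Z \<inter> {n+1..n+m}))"
    if Z: "Z \<subseteq> ?V" "Z \<noteq> {}" and cut: "\<And>i j. i \<in> Z \<Longrightarrow> j \<in> ?V - Z \<Longrightarrow> h i \<noteq> h j" for Z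
  proof -
    have "A i j + A j i = 0" if "i \<in> Z" "j \<in> ?V - Z" for i j
    proof -
      have "\<not> 0 < A i j" "\<not> 0 < A j i" using h[of i j] h[of j i] cut[OF that] that Z by auto
      then have "A i j = 0" "A j i = 0" using A0[of i j] A0[of j i] by (simp_all add: antisym not_less)
      then show ?thesis by simp
    qed
    then have "(\<Sum>i\<in>Z. \<Sum>j\<in>?V - Z. A i j + A j i) = 0"
      by (intro sum.neutral ballI)
    then have "out_edges n m E Z Z = 0"
      using sum_adjacency_eq_out_edges[OF E Z(1) A, of Z] by simp
    moreover have "0 \<le> right_deg n m d" by (simp add: right_deg_def)
    ultimately have "64 * real (out_edges n m E Z Z) \<le> left_vol n d Z + right_vol n m d Z"
      by (simp add: left_vol_def right_vol_def)
    then show ?thesis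
      using chain_reaches_right_half[OF G nm d N D, of "\<lambda>_. Z" T] Z T by blast
  qed
  have "1 \<in> X" using nm by (simp add: X_def)
  then have "real m < 2 * real (card (X \<inter> {n+1..n+m}))"
    by (intro large) (auto simp: X_def)
  moreover have "Y \<noteq> {}" using neg by (auto simp: Y_def)
  then have "real m < 2 * real (card (Y \<inter> {n+1..n+m}))"
    by (intro large) (auto simp: Y_def)
  ultimately show False
    using right_halves_meet[OF G nm d N D, of X Y] by (auto simp: X_def Y_def)
qed

lemma mle_close:
  assumes u1: "u 1 = 0" and A0: "\<And>i j. 0 \<le> A i j"
    and A: "\<And>i j. A i j + A j i = of_bool ((i, j) \<in> E) + of_bool ((j, i) \<in> E)"
    and M: "\<And>i j. i \<in> {1..n+m} \<Longrightarrow> j \<in> {1..n+m} \<Longrightarrow> u i - u j \<le> M"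
    and noise: "\<And>i. i \<in> {1..n+m} \<Longrightarrow> \<bar>noise (n + m) A u i\<bar> \<le> 6 * \<epsilon> * vweight n m d i"
    and \<epsilon>: "0 < \<epsilon>" and \<tau>: "\<tau> = 384 * \<epsilon> / (logistic (- (M + 1)))\<^sup>2"
    and T: "real n < sqrt (right_deg n m d) ^ T"
    and small: "2 * real (T + 2) * \<tau> < 1"
  shows "(\<exists>!v. is_mle (n + m) A v) \<and>
    (\<forall>v. is_mle (n + m) A v \<longrightarrow> sup_dist (n + m) v u \<le> 2 * real (T + 2) * \<tau>)"
proof -
  have N1: "1 \<le> n + m" using nm by simp
  obtain v where v: "v \<in> extensional {1..n+m}" "v 1 = 0" and max: "near_max (n + m) A u v"
    using ex_near_max[OF N1, of u] u1 by blast
  have range: "(v i - u i) - (v j - u j) \<le> 2 * real (T + 2) * \<tau>"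
    if "i \<in> {1..n+m}" "j \<in> {1..n+m}" for i j
    by (rule near_max_range[OF max A0 A M noise \<epsilon> \<tau> T that])
  have conn: "\<forall>i\<in>{1..n+m}. h i = h 1"
    if "\<And>i j. i \<in> {1..n+m} \<Longrightarrow> j \<in> {1..n+m} \<Longrightarrow> 0 < A i j \<Longrightarrow> h i = h j" for h :: "nat \<Rightarrow> real"
    using good_graph_connected[OF A0 A that T] .
  have mle: "is_mle (n + m) A v \<and> (\<forall>w. is_mle (n + m) A w \<longrightarrow> w = v)"
    by (rule near_max_interior_is_mle[OF N1 max v range small A0 conn])
  \<comment> \<open>Both vectors vanish at 1, so comparing with that coordinate turns the range
    bound into a sup-norm bound.\<close>
  have "\<bar>v i - u i\<bar> \<le> 2 * real (T + 2) * \<tau>" if "i \<in> {1..n+m}" for i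
    using range[OF that, of 1] range[OF _ that, of 1] N1 v u1 by (simp add: abs_le_iff)
  then have "sup_dist (n + m) v u \<le> 2 * real (T + 2) * \<tau>"
    unfolding sup_dist_def using N1 by (subst Max_le_iff) auto
  then show ?thesis using mle by metis
qed

end

section \<open>The bound for fixed sizes and the passage to the limit\<close>

lemma prob_mle_close:
  fixes n m d :: nat and u :: "nat \<Rightarrow> real" and M c :: real
  defines "D \<equiv> real n / real m * real d"
  defines "bound \<equiv> 3840 / (logistic (- (M + 1)))\<^sup>2 * (ln (real n) / ln D)
     * sqrt (real m * ln (real (n + m)) / (real n * real d))"
  assumes nm: "1 \<le> n" "n \<le> m" and d: "1 \<le> d" "d \<le> m" and N: "3 \<le> n + m" and u1: "u 1 = 0"
    and M: "merit_range (n + m) u \<le> M"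
    and D: "65536 * ln (real (n + m)) ^ 2 \<le> D"
    and small: "bound < 1"
  shows "1 - 2 / real (n + m) ^ 2 \<le> measure_pmf.prob (btl_pmf n m d u)
    {A. (\<exists>!v. is_mle (n + m) A v) \<and>
      (\<forall>v. is_mle (n + m) A v \<longrightarrow> sup_dist (n + m) v u \<le> bound)}"
proof -
  define L where "L = ln (real (n + m))"
  define \<epsilon> where "\<epsilon> = sqrt (L / D)"
  define \<tau> where "\<tau> = 384 * \<epsilon> / (logistic (- (M + 1)))\<^sup>2"
  define x where "x = ln (real n) / ln D"
  \<comment> \<open>An integer above \<open>2 x\<close>, which makes \<open>sqrt D ^ T\<close>
    exceed \<open>n\<close>.\<close>
  define T where "T = nat \<lfloor>2 * x\<rfloor> + 1"
  have Dr: "right_deg n m d = D" by (simp add: right_deg_def D_def)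
  have D': "65536 * ln (real (n + m)) ^ 2 \<le> right_deg n m d" using D Dr by simp
  have L1: "1 \<le> L"
  proof -
    have "exp 1 \<le> real (n + m)" using exp_le N by linarith
    then show ?thesis using N unfolding L_def by (subst ln_ge_iff) auto
  qed
  have "L * 1 \<le> L * L" using L1 by (intro mult_left_mono) auto
  then have DL: "65536 * L \<le> D" using D by (simp add: L_def power2_eq_square)
  have D1: "1 < D" using DL L1 by linarith
  have DL': "L \<le> D" using DL L1 by linarith
  \<comment> \<open>This gives \<open>x \<ge> 1\<close>, so additive constants in the number of
    steps are absorbed into a multiple of \<open>x\<close>.\<close>
  have Dn: "D \<le> real n"
  proof -
    have "real n * real d \<le> real n * real m" using d by (intro mult_left_mono) auto
    then show ?thesis using nm by (simp add: D_def field_simps)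
  qed
  have Dd: "right_deg n m d \<le> real d"
    unfolding right_deg_def using nm mult_right_mono[of "real n / real m" 1 "real d"] by simp
  have \<epsilon>: "0 < \<epsilon>" "\<epsilon> \<le> 1" using L1 D1 DL' by (auto simp: \<epsilon>_def)
  have \<epsilon>2: "L \<le> \<epsilon>\<^sup>2 * right_deg n m d" using L1 D1 by (simp add: \<epsilon>_def Dr)
  have lnD: "0 < ln D" "ln D \<le> ln (real n)" using D1 Dn by auto
  have x1: "1 \<le> x" using lnD by (simp add: x_def)
  have T: "real n < sqrt (right_deg n m d) ^ T"
  proof -
    have "2 * x < real T" using x1 unfolding T_def by linarith
    then have "2 * x * (ln D / 2) < real T * (ln D / 2)" using lnD by (intro mult_strict_right_mono) auto
    then have "ln (real n) < real T * ln (sqrt D)" using lnD D1 by (simp add: x_def ln_sqrt)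
    then have "exp (ln (real n)) < exp (real T * ln (sqrt D))" by simp
    then show ?thesis using nm D1 by (simp add: exp_of_nat_mult Dr)
  qed
  have range_le: "2 * real (T + 2) * \<tau> \<le> bound"
  proof -
    \<comment> \<open>Indeed \<open>T + 2 \<le> 2 x + 3\<close>. The final constant is
      \<open>3840 = 2 * 5 * 384\<close>.\<close>
    have "real (T + 2) \<le> 5 * x" using x1 unfolding T_def by linarith
    moreover have "0 \<le> \<tau>" using \<epsilon> by (simp add: \<tau>_def)
    ultimately have "2 * real (T + 2) * \<tau> \<le> 2 * (5 * x) * \<tau>"
      by (intro mult_right_mono mult_left_mono) auto
    also have "\<dots> = 3840 / (logistic (- (M + 1)))\<^sup>2 * x * \<epsilon>" by (simp add: \<tau>_def)
    also have "\<epsilon> = sqrt (real m * ln (real (n + m)) / (real n * real d))"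
      using nm d by (simp add: \<epsilon>_def L_def D_def field_simps)
    finally show ?thesis by (simp add: bound_def x_def)
  qed
  have uM: "u i - u j \<le> M" if "i \<in> {1..n+m}" "j \<in> {1..n+m}" for i j
  proof -
    have "u i - u j \<le> merit_range (n + m) u"
      unfolding merit_range_def using that by (intro Max_ge) auto
    then show ?thesis using M by simp
  qed
  let ?R = "\<lambda>A. (\<exists>!v. is_mle (n + m) A v) \<and>
      (\<forall>v. is_mle (n + m) A v \<longrightarrow> sup_dist (n + m) v u \<le> bound)"
  have "1 - (1 / real (n + m) ^ 2 + 1 / real (n + m) ^ 2) \<le> measure_pmf.prob (btl_pmf n m d u) {A. ?R A}"
    unfolding btl_pmf_def
  proof (rule prob_bind_pmf_not_le)
    show "measure_pmf.prob (bipartite_graph_pmf n m d) {E. \<not> good_graph n m d E} \<le> 1 / real (n + m) ^ 2"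
      using nm d N DL by (intro prob_not_good_graph) (auto simp: Dr L_def)
    fix E assume G: "good_graph n m d E"
    have E: "E \<subseteq> {1..n} \<times> {n+1..n+m}" using G by (simp add: good_graph_def)
    let ?ok = "\<lambda>w. \<forall>i\<in>{1..n+m}. \<bar>noise (n + m) (win_matrix E w) u i\<bar> \<le> 6 * \<epsilon> * vweight n m d i"
    have "measure_pmf.prob (map_pmf (win_matrix E) (comparison_pmf u E)) {A. \<not> ?R A}
        = measure_pmf.prob (comparison_pmf u E) {w. \<not> ?R (win_matrix E w)}"
      by (simp add: vimage_def)
    also have "\<dots> \<le> measure_pmf.prob (comparison_pmf u E) {w. \<not> ?ok w}"
    proof (rule measure_pmf.finite_measure_mono)
      have "?R (win_matrix E w)" if ok: "?ok w" for w
      proof -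
        have "(j, i) \<notin> E" if "(i, j) \<in> E" for i j
          using subsetD[OF E, of "(i, j)"] subsetD[OF E, of "(j, i)"] that by auto
        then have A: "win_matrix E w i j + win_matrix E w j i = of_bool ((i, j) \<in> E) + of_bool ((j, i) \<in> E)" for i j
          by (auto simp: win_matrix_def)
        have "(\<exists>!v. is_mle (n + m) (win_matrix E w) v) \<and>
          (\<forall>v. is_mle (n + m) (win_matrix E w) v \<longrightarrow> sup_dist (n + m) v u \<le> 2 * real (T + 2) * \<tau>)"
        proof (rule mle_close[where u = u and A = "win_matrix E w", OF G nm d(1) N D' u1 _ A uM _ \<epsilon>(1) \<tau>_def T])
          show "0 \<le> win_matrix E w i j" for i j by (simp add: win_matrix_def)
          show "\<bar>noise (n + m) (win_matrix E w) u i\<bar> \<le> 6 * \<epsilon> * vweight n m d i" if "i \<in> {1..n+m}" for i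
            using ok that by blast
          show "2 * real (T + 2) * \<tau> < 1" using range_le small by linarith
        qed
        then show ?thesis using range_le by (meson order_trans)
      qed
      then show "{w. \<not> ?R (win_matrix E w)} \<subseteq> {w. \<not> ?ok w}" by blast
    qed simp
    also have "\<dots> \<le> 1 / real (n + m) ^ 2"
      using N D1 Dd \<epsilon> \<epsilon>2 by (intro prob_noise[OF G]) (auto simp: Dr L_def)
    finally show "measure_pmf.prob (map_pmf (win_matrix E) (comparison_pmf u E)) {A. \<not> ?R A}
      \<le> 1 / real (n + m) ^ 2" .
  qed simp
  then show ?thesis by simp
qed

text \<open>The bound for fixed sizes applies once \<open>D \<ge> 65536 L^2\<close> and the error
  bound is below 1, where \<open>L = ln (n + m)\<close>. Both hold eventually because
  \<open>D \<ge> c L^3\<close>: the first when \<open>c L \<ge> 65536\<close>, the second because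
  the error bound is of order \<open>1 / ln L\<close>.\<close>

theorem corollary15:
  fixes n m :: "nat \<Rightarrow> nat"
    and d :: "nat \<Rightarrow> nat \<Rightarrow> nat"
    and u :: "nat \<Rightarrow> nat \<Rightarrow> nat \<Rightarrow> real"
  assumes "\<And>k. n k \<le> m k"
    and "filterlim n at_top sequentially"
    and "filterlim m at_top sequentially"
    and "\<And>k. 1 \<le> d (n k) (m k)"
    and "\<And>k. d (n k) (m k) \<le> m k"
    and "\<And>k. u (n k) (m k) 1 = 0"
    and "(\<lambda>k. merit_range (n k + m k) (u (n k) (m k))) \<in> O(\<lambda>_. 1)"
    and "(\<lambda>k. real (d (n k) (m k))) \<in>
           \<Omega>(\<lambda>k. real (m k) * ln (real (n k + m k)) ^ 3 / real (n k))"
  shows "\<exists>C::real. \<forall>\<^sub>F k in sequentially.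
    measure_pmf.prob (btl_pmf (n k) (m k) (d (n k) (m k)) (u (n k) (m k)))
      {A. (\<exists>!v. is_mle (n k + m k) A v) \<and>
          (\<forall>v. is_mle (n k + m k) A v \<longrightarrow>
             sup_dist (n k + m k) v (u (n k) (m k)) \<le>
               C * (ln (real (n k)) / ln (real (n k) / real (m k) * real (d (n k) (m k))))
                 * sqrt (real (m k) * ln (real (n k + m k)) / (real (n k) * real (d (n k) (m k)))))}
      \<ge> 1 - 2 / real (n k + m k) ^ 2"
proof -
  obtain M where M: "\<forall>\<^sub>F k in sequentially. norm (merit_range (n k + m k) (u (n k) (m k))) \<le> M * norm (1::real)"
    using assms(7) by (elim landau_o.bigE)
  obtain c where c: "0 < c" and dc: "\<forall>\<^sub>F k in sequentially. norm (real (d (n k) (m k))) \<ge>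
      c * norm (real (m k) * ln (real (n k + m k)) ^ 3 / real (n k))"
    using assms(8) by (elim landau_omega.bigE)
  define b where "b = (logistic (- (M + 1)))\<^sup>2"
  have b: "0 < b" using logistic_pos[of "- (M + 1)"] by (simp add: b_def)
  have N_lim: "filterlim (\<lambda>k. real (n k + m k)) at_top sequentially"
    by (intro filterlim_compose[OF filterlim_real_sequentially] filterlim_at_top_mono[OF assms(2)]) simp
  then have L_lim: "filterlim (\<lambda>k. ln (real (n k + m k))) at_top sequentially"
    by (rule filterlim_compose[OF ln_at_top])
  then have LL_lim: "filterlim (\<lambda>k. ln (ln (real (n k + m k)))) at_top sequentially"
    by (rule filterlim_compose[OF ln_at_top])
  have "\<forall>\<^sub>F k in sequentially. 1 \<le> n k"
    using assms(2) by (simp add: filterlim_at_top)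
  moreover have "\<forall>\<^sub>F k in sequentially. 3 \<le> real (n k + m k)"
    using N_lim by (simp only: filterlim_at_top)
  moreover have "\<forall>\<^sub>F k in sequentially. max 1 (65536 / c) \<le> ln (real (n k + m k))"
    using L_lim by (simp only: filterlim_at_top)
  moreover have "\<forall>\<^sub>F k in sequentially. 3840 / (b * sqrt c) + 1 \<le> ln (ln (real (n k + m k)))"
    using LL_lim by (simp only: filterlim_at_top)
  ultimately have "\<forall>\<^sub>F k in sequentially.
    measure_pmf.prob (btl_pmf (n k) (m k) (d (n k) (m k)) (u (n k) (m k)))
      {A. (\<exists>!v. is_mle (n k + m k) A v) \<and>
          (\<forall>v. is_mle (n k + m k) A v \<longrightarrow>
             sup_dist (n k + m k) v (u (n k) (m k)) \<le>
               3840 / b * (ln (real (n k)) / ln (real (n k) / real (m k) * real (d (n k) (m k))))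
                 * sqrt (real (m k) * ln (real (n k + m k)) / (real (n k) * real (d (n k) (m k)))))}
      \<ge> 1 - 2 / real (n k + m k) ^ 2"
    using M dc
  proof eventually_elim
    case (elim k)
    define L where "L = ln (real (n k + m k))"
    define D where "D = real (n k) / real (m k) * real (d (n k) (m k))"
    have n1: "1 \<le> n k" and m1: "1 \<le> m k" using elim(1) assms(1)[of k] by auto
    have L: "1 \<le> L" "65536 / c \<le> L" "3840 / (b * sqrt c) < ln L"
      using elim(3,4) by (auto simp: L_def)
    have "c * (real (m k) * L ^ 3 / real (n k)) \<le> real (d (n k) (m k))"
      using elim(6) L(1) by (simp add: L_def)
    then have "c * (real (m k) * L ^ 3 / real (n k)) * (real (n k) / real (m k))
        \<le> real (d (n k) (m k)) * (real (n k) / real (m k))"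
      by (intro mult_right_mono) auto
    then have Dc: "c * L ^ 3 \<le> D" using n1 m1 by (simp add: D_def field_simps)
    have cL: "65536 \<le> c * L" using L(2) c by (simp add: field_simps)
    have D: "65536 * L\<^sup>2 \<le> D"
    proof -
      have "65536 * L\<^sup>2 \<le> c * L * L\<^sup>2" using cL by (intro mult_right_mono) auto
      then show ?thesis using Dc by (simp add: power2_eq_square power3_eq_cube mult_ac)
    qed
    have LD: "L \<le> D"
    proof -
      have "L * 1 \<le> L * L" using L(1) by (intro mult_left_mono) auto
      then show ?thesis using D[unfolded power2_eq_square] L(1) by linarith
    qed
    have lnL: "0 < ln L"
    proof -
      have "0 \<le> 3840 / (b * sqrt c)" using b c by simp
      then show ?thesis using L(3) by linarith
    qed
    have lnD: "ln L \<le> ln D" using LD L(1) by simp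
    \<comment> \<open>The third power of the logarithm is used in full here:
      \<open>sqrt (L / D)\<close> is of order \<open>1 / L\<close> and cancels the \<open>L\<close>
      in \<open>ln n / ln D \<le> L / ln L\<close>.\<close>
    have eps: "sqrt (L / D) * (sqrt c * L) \<le> 1"
    proof -
      have "L * (c * L\<^sup>2) \<le> D" using Dc by (simp add: power2_eq_square power3_eq_cube mult_ac)
      then have "L / D * (c * L\<^sup>2) \<le> 1" using LD L(1) by (simp add: field_simps)
      then have "sqrt (L / D * (c * L\<^sup>2)) \<le> sqrt 1" by (rule real_sqrt_le_mono)
      moreover have "sqrt (L / D * (c * L\<^sup>2)) = sqrt (L / D) * (sqrt c * L)"
        unfolding real_sqrt_mult using L(1) by simp
      ultimately show ?thesis by (simp only: real_sqrt_one)
    qed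
    have "3840 / b * (ln (real (n k)) / ln D) * sqrt (L / D) < 1"
    proof -
      have "0 \<le> ln (real (n k))" "ln (real (n k)) \<le> L" using n1 by (auto simp: L_def)
      then have "ln (real (n k)) / ln D \<le> L / ln L"
        using lnL lnD by (intro frac_le) auto
      then have "3840 / b * (ln (real (n k)) / ln D) * sqrt (L / D) \<le> 3840 / b * (L / ln L) * sqrt (L / D)"
        using b LD L(1) by (intro mult_right_mono mult_left_mono) auto
      also have "\<dots> = 3840 / (b * sqrt c * ln L) * (sqrt (L / D) * (sqrt c * L))"
        using c by (simp add: field_simps)
      also have "\<dots> \<le> 3840 / (b * sqrt c * ln L) * 1"
        using eps b c lnL by (intro mult_left_mono) auto
      also have "\<dots> < 1" using L(3) b c lnL by (simp add: field_simps)
      finally show ?thesis .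
    qed
    moreover have "L / D = real (m k) * ln (real (n k + m k)) / (real (n k) * real (d (n k) (m k)))"
      using n1 m1 by (simp add: L_def D_def)
    ultimately have small: "3840 / (logistic (- (M + 1)))\<^sup>2 *
        (ln (real (n k)) / ln (real (n k) / real (m k) * real (d (n k) (m k))))
        * sqrt (real (m k) * ln (real (n k + m k)) / (real (n k) * real (d (n k) (m k)))) < 1"
      by (simp only: b_def D_def)
    have "3 \<le> n k + m k" using elim(2) by linarith
    moreover have "merit_range (n k + m k) (u (n k) (m k)) \<le> M" using elim(5) by simp
    ultimately show ?case
      unfolding b_def using n1 D assms(1,4,5,6)
      by (intro prob_mle_close small) (auto simp: L_def D_def)
  qed
  then show ?thesis by blast
qed

end
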